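(* Let $d\ge2$, $1\le k\le d-1$, $p=\frac{d+1}{k+1}$, $q=d+1$. Let $(f_n)$ be an extremizing sequence for the inequality $|\mathcal T f|_{L^q((0,\infty),r^{d-k-1}dr)}\le A_{\mathcal T}|f|_{L^p((0,\infty),r^{d-1}dr)}$. Then $(f_n)$ is relatively compact in $L^p((0,\infty),r^{d-1}dr)$ modulo the group of dilations; that is, there exist a subsequence $f_{\varphi(n)}$ and a sequence $\lambda_{\varphi(n)}>0$ such that the rescaled sequence $$\lambda_{\varphi(n)}^{d/p}\,f_{\varphi(n)}(\lambda_{\varphi(n)}\,\cdot)$$ converges strongly in $L^p((0,\infty),r^{d-1}dr)$.
   Context: $\mathcal T$ is the operator $$\mathcal T f(r)=\int_0^\infty f(\sqrt{r^2+s^2})\,s^{k-1}ds=\int_r^\infty f(u)(u^2-r^2)^{k/2-1}u\,du,\qquad r>0,$$ which is bounded from $L^p((0,\infty),r^{d-1}dr)$ to $L^q((0,\infty),r^{d-k-1}dr)$; $A_{\mathcal T}$ denotes its operator norm (the optimal constant). A sequence $(f_n)$ is an extremizing sequence for this inequality if $|f_n|_{L^p((0,\infty),r^{d-1}dr)}=1$ for all $n$ and $|\mathcal T f_n|_{L^q((0,\infty),r^{d-k-1}dr)}\to A_{\mathcal T}$ as $n\to\infty$. *)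

theory Defs
  imports "HOL-Analysis.Analysis"
begin

text \<open>The measure \<open>r\<^sup>m\<^sup>-\<^sup>1 dr\<close> on \<open>(0,\<infinity>)\<close>. Functions on \<open>(0,\<infinity>)\<close> are represented by functions of type
  \<open>real \<Rightarrow> real\<close>; because of the restriction to \<open>(0,\<infinity>)\<close>, their values elsewhere do not matter,
  not even for measurability.\<close>

definition radial_measure :: "nat \<Rightarrow> real measure" where
  "radial_measure m =
     density (restrict_space lborel {0<..}) (\<lambda>r. ennreal (r ^ (m - 1)))"

text \<open>The norm takes the value \<open>\<infinity>\<close> when the integral diverges; the case distinction is there because
  there is no \<open>powr\<close> on \<^typ>\<open>ennreal\<close>.\<close>

definition Lp_norm :: "real \<Rightarrow> 'a measure \<Rightarrow> ('a \<Rightarrow> real) \<Rightarrow> ennreal" where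
  "Lp_norm p M f =
     (let I = (\<integral>\<^sup>+ x. ennreal (\<bar>f x\<bar> powr p) \<partial>M)
      in if I = \<infinity> then \<infinity> else ennreal (enn2real I powr (1 / p)))"

definition Lp_space :: "real \<Rightarrow> 'a measure \<Rightarrow> ('a \<Rightarrow> real) set" where
  "Lp_space p M = {f \<in> borel_measurable M. Lp_norm p M f < \<infinity>}"

definition T_op :: "nat \<Rightarrow> (real \<Rightarrow> real) \<Rightarrow> real \<Rightarrow> real" where
  "T_op k f r = (LINT s:{0<..}|lborel. f (sqrt (r\<^sup>2 + s\<^sup>2)) * s ^ (k - 1))"

text \<open>The optimal constant, i.e. the operator norm of \<^const>\<open>T_op\<close>, from
  \<open>L\<^sup>p((0,\<infinity>), r\<^sup>d\<^sup>-\<^sup>1 dr)\<close> to \<open>L\<^sup>q((0,\<infinity>), r\<^sup>d\<^sup>-\<^sup>k\<^sup>-\<^sup>1 dr)\<close>. It is an \<^typ>\<open>ennreal\<close>, so that the infimum is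
  meaningful without presupposing boundedness.\<close>

definition A_const :: "nat \<Rightarrow> nat \<Rightarrow> real \<Rightarrow> real \<Rightarrow> ennreal" where
  "A_const d k p q =
     Inf {C. \<forall>f \<in> Lp_space p (radial_measure d).
               Lp_norm q (radial_measure (d - k)) (T_op k f)
                 \<le> C * Lp_norm p (radial_measure d) f}"

definition extremizing_seq ::
  "nat \<Rightarrow> nat \<Rightarrow> real \<Rightarrow> real \<Rightarrow> (nat \<Rightarrow> real \<Rightarrow> real) \<Rightarrow> bool" where
  "extremizing_seq d k p q f \<longleftrightarrow>
     (\<forall>n. f n \<in> Lp_space p (radial_measure d) \<and> Lp_norm p (radial_measure d) (f n) = 1) \<and>
     (\<lambda>n. Lp_norm q (radial_measure (d - k)) (T_op k (f n))) \<longlonglongrightarrow> A_const d k p q"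

end

theory Submission
  imports Defs "HOL-Complex_Analysis.Great_Picard" "HOL-Library.Diagonal_Subsequence"
begin

text \<open>
  The substitution \<open>r = e\<^sup>t\<close>, with \<open>f r = r powr (- d / p) * g (ln r)\<close>, is isometric from
  \<open>L\<^sup>p(r\<^sup>d\<^sup>-\<^sup>1 dr)\<close> to \<open>L\<^sup>p(\<real>)\<close>; it turns dilations into translations and the operator into a
  correlation \<open>t \<mapsto> \<integral> g (t + v) K v dv\<close> with an explicit kernel \<open>K\<close> that vanishes for \<open>v \<le> 0\<close>
  (\<open>T_op_radial_profile\<close>). For \<open>s = (d + 1) / (d + 1 - k)\<close> one has \<open>1 / p + 1 / s = 1 + 1 / q\<close> and
  \<open>K \<in> L\<^sup>s\<close> (\<open>log_kernel_in_Lp\<close>): the singularity at \<open>0\<close> is integrable because \<open>s < 2\<close> when \<open>k = 1\<close>,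
  and \<open>K\<close> decays exponentially. So the theorem is a case of the fact that for \<open>1 < p < q\<close> and every
  nonzero \<open>K \<in> L\<^sup>s\<close> the extremizing sequences of \<open>L\<^sup>p \<rightarrow> L\<^sup>q\<close>, \<open>g \<mapsto> conv K g\<close> are relatively compact modulo
  translations (\<open>extremizing_precompact\<close>).

  Young's inequality allows one to replace \<open>K\<close>, with a small error in operator norm, by a continuous
  kernel \<open>H\<close> supported in some \<open>[-L, L]\<close>. Three things follow.

  \<^item> No vanishing (\<open>window_with_mass\<close>): if all windows of length \<open>2 L\<close> carry little \<open>L\<^sup>p\<close> mass of \<open>f\<close>,
    then the \<open>q\<close>-th power of the norm of \<open>conv H f\<close> is small, by a factor \<open>(largest mass) powr (q / p - 1)\<close>.
    So after translations a fixed interval carries a fixed amount of mass.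

  \<^item> No dichotomy (\<open>tightness\<close>): if a fixed amount of mass were also far away, then a gap of length
    \<open>2 L\<close> with hardly any mass would split \<open>f\<close> into two pieces whose images under \<open>H\<close> have disjoint
    supports. Then \<open>q\<close>-th powers of norms add in the image while \<open>p\<close>-th powers add in the source,
    and \<open>q > p\<close> makes such a splitting strictly worse than the best constant.

  \<^item> Compactness (\<open>conv_compact\<close>): for a tight sequence, the images are close to an equicontinuous
    family on a fixed interval, so by Arzela-Ascoli they have Cauchy subsequences in \<open>L\<^sup>q\<close>.

  Finally, weak limits are avoided altogether. If the images of \<open>f i\<close> and \<open>f j\<close> are close, then the
  midpoint of \<open>f i\<close> and \<open>f j\<close> is nearly extremal too, so its norm is close to \<open>1\<close>, and the uniform
  convexity of \<open>L\<^sup>p\<close> (\<open>uniform_convexity_Lp\<close>) forces \<open>f i\<close> and \<open>f j\<close> to be close. Hence the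
  subsequence itself is Cauchy, and \<open>L\<^sup>p\<close> is complete.
\<close>

section \<open>Convexity of powers\<close>

lemma continuous_on_abs_powr:
  fixes f :: "'a::topological_space \<Rightarrow> real"
  assumes "1 < p" "continuous_on S f"
  shows "continuous_on S (\<lambda>x. \<bar>f x\<bar> powr p)"
  by (intro continuous_on_powr' continuous_on_rabs continuous_on_const assms(2)) (use assms(1) in auto)

text \<open>Both the convexity of powers and its strict form at midpoints come from this. By the mean value theorem
the difference of the two sides is \<open>p * (z powr (p - 1) - m powr (p - 1)) * (x - m)\<close> for some \<open>z\<close> between \<open>x\<close>
and \<open>m\<close>, and the two factors have the same sign.\<close>
lemma powr_tangent_less:
  fixes x m p :: real
  assumes p: "1 < p" and x: "0 \<le> x" and m: "0 < m" and ne: "x \<noteq> m"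
  shows "m powr p + p * m powr (p - 1) * (x - m) < x powr p"
proof -
  let ?h = "\<lambda>y. y powr p - p * m powr (p - 1) * y"
  let ?h' = "\<lambda>y. p * (y powr (p - 1) - m powr (p - 1))"
  have D: "(?h has_derivative (*) (?h' y)) (at y)" if "0 < y" for y
  proof -
    have "(?h has_real_derivative ?h' y) (at y)"
      using that by (auto intro!: derivative_eq_intros simp: algebra_simps)
    then show ?thesis by (simp add: has_field_derivative_def)
  qed
  have cont: "continuous_on {a..b} ?h" if "0 \<le> a" for a b
    by (intro continuous_on_diff continuous_on_powr' continuous_on_mult continuous_on_const continuous_on_id)
      (use p that in auto)
  have "?h m < ?h x"
  proof (cases "x < m")
    case True
    obtain z where z: "x < z" "z < m" "?h m - ?h x = ?h' z * (m - x)"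
      by (rule mvt[OF True cont[OF x], of "\<lambda>y. (*) (?h' y)"]) (use D x in \<open>auto simp only: intro: order_le_less_trans\<close>)
    have "z powr (p - 1) < m powr (p - 1)"
      using z x p by (intro powr_less_mono2) auto
    then have "?h' z * (m - x) < 0"
      using True p by (simp add: mult_less_0_iff)
    then show ?thesis using z by linarith
  next
    case False
    then have mx: "m < x" using ne by simp
    obtain z where z: "m < z" "z < x" "?h x - ?h m = ?h' z * (x - m)"
      by (rule mvt[OF mx cont, of "\<lambda>y. (*) (?h' y)"]) (use D m in \<open>auto simp only: intro: less_trans order_less_imp_le\<close>)
    have "m powr (p - 1) < z powr (p - 1)"
      using z m p by (intro powr_less_mono2) auto
    then have "?h' z * (x - m) > 0"
      using mx p by simp
    then show ?thesis using z by linarith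
  qed
  moreover have "m powr p = m powr (p - 1) * m"
    using m by (simp add: powr_mult_base mult.commute)
  ultimately show ?thesis by (simp add: algebra_simps)
qed

lemma powr_convex_combination:
  fixes x y p l :: real
  assumes p: "1 < p" and x: "0 \<le> x" and y: "0 \<le> y" and l: "0 \<le> l" "l \<le> 1"
  shows "(l * x + (1 - l) * y) powr p \<le> l * x powr p + (1 - l) * y powr p"
proof (cases "l * x + (1 - l) * y = 0")
  case True
  then show ?thesis using l by simp
next
  case False
  define m where "m = l * x + (1 - l) * y"
  have m: "0 < m" using False x y l unfolding m_def by (smt (verit) mult_nonneg_nonneg)
  have tan: "m powr p + p * m powr (p - 1) * (z - m) \<le> z powr p" if "0 \<le> z" for z
    using powr_tangent_less[OF p that m] by (cases "z = m") auto
  have "l * (m powr p + p * m powr (p - 1) * (x - m))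
      + (1 - l) * (m powr p + p * m powr (p - 1) * (y - m)) \<le> l * x powr p + (1 - l) * y powr p"
    using l by (intro add_mono mult_left_mono tan x y) auto
  moreover have "l * (m powr p + p * m powr (p - 1) * (x - m))
      + (1 - l) * (m powr p + p * m powr (p - 1) * (y - m))
      = m powr p + p * m powr (p - 1) * (l * x + (1 - l) * y - m)"
    by (simp add: algebra_simps)
  ultimately show ?thesis by (simp add: m_def)
qed

lemma abs_powr_midpoint_less:
  fixes a b p :: real
  assumes p: "1 < p" and ne: "a \<noteq> b"
  shows "\<bar>(a + b) / 2\<bar> powr p < (\<bar>a\<bar> powr p + \<bar>b\<bar> powr p) / 2"
proof (cases "\<bar>a\<bar> = \<bar>b\<bar>")
  case True
  then have "a = - b" "b \<noteq> 0" using ne by auto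
  then show ?thesis by simp
next
  case False
  define m where "m = (\<bar>a\<bar> + \<bar>b\<bar>) / 2"
  have m: "0 < m" "\<bar>a\<bar> \<noteq> m" "\<bar>b\<bar> \<noteq> m" using False by (auto simp: m_def)
  have "\<bar>(a + b) / 2\<bar> powr p \<le> m powr p"
    using p by (intro powr_mono2) (auto simp: m_def)
  moreover have "m powr p + p * m powr (p - 1) * (\<bar>a\<bar> - m) < \<bar>a\<bar> powr p"
    "m powr p + p * m powr (p - 1) * (\<bar>b\<bar> - m) < \<bar>b\<bar> powr p"
    using m by (auto intro!: powr_tangent_less p)
  moreover have "p * m powr (p - 1) * (\<bar>a\<bar> - m) + p * m powr (p - 1) * (\<bar>b\<bar> - m) = 0"
    by (simp add: m_def algebra_simps add_divide_distrib)
  ultimately show ?thesis by argo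
qed

lemma abs_add_powr_le:
  fixes a b p :: real
  assumes "1 < p"
  shows "\<bar>a + b\<bar> powr p \<le> 2 powr p * (\<bar>a\<bar> powr p + \<bar>b\<bar> powr p)"
proof -
  have "\<bar>a + b\<bar> powr p \<le> (2 * max \<bar>a\<bar> \<bar>b\<bar>) powr p"
    using assms by (intro powr_mono2) auto
  also have "\<dots> = 2 powr p * (max \<bar>a\<bar> \<bar>b\<bar>) powr p"
    by (simp add: powr_mult)
  also have "(max \<bar>a\<bar> \<bar>b\<bar>) powr p \<le> \<bar>a\<bar> powr p + \<bar>b\<bar> powr p"
    by (simp add: max_def)
  finally show ?thesis by simp
qed

text \<open>Both sides are homogeneous of degree \<open>p\<close> in \<open>(a, b)\<close>, so it suffices to look at the unit circle. On
the compact part of it where \<open>\<bar>a - b\<bar> powr p\<close> exceeds the term with \<open>e\<close>, the midpoint defect is positive by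
strict convexity and \<open>C\<close> is the maximum of a quotient. Unlike Clarkson's inequalities, this treats
all \<open>p > 1\<close> alike.\<close>
lemma uniform_convexity_pointwise:
  fixes p e :: real
  assumes p: "1 < p" and e: "0 < e"
  obtains C where "0 \<le> C"
    "\<And>a b :: real. \<bar>a - b\<bar> powr p \<le> e * (\<bar>a\<bar> powr p + \<bar>b\<bar> powr p)
        + C * ((\<bar>a\<bar> powr p + \<bar>b\<bar> powr p) / 2 - \<bar>(a + b) / 2\<bar> powr p)"
proof -
  define D where "D = (\<lambda>z::real \<times> real. (\<bar>fst z\<bar> powr p + \<bar>snd z\<bar> powr p) / 2 - \<bar>(fst z + snd z) / 2\<bar> powr p)"
  define E where "E = (\<lambda>z::real \<times> real. \<bar>fst z - snd z\<bar> powr p - e * (\<bar>fst z\<bar> powr p + \<bar>snd z\<bar> powr p))"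
  define S where "S = sphere (0::real \<times> real) 1 \<inter> {z. 0 \<le> E z}"
  have contD: "continuous_on UNIV D" and contE: "continuous_on UNIV E"
    unfolding D_def E_def by (intro continuous_intros continuous_on_abs_powr p; simp)+
  have "compact S"
    unfolding S_def using contE
    by (intro compact_Int_closed compact_sphere closed_Collect_le) auto
  have Dpos: "0 < D z" if "0 < E z \<or> z \<in> S" for z
  proof -
    have "fst z \<noteq> snd z"
    proof
      assume eq: "fst z = snd z"
      have "E z = - (e * (\<bar>fst z\<bar> powr p + \<bar>fst z\<bar> powr p))" using p by (simp add: E_def eq)
      moreover have "0 \<le> E z" using that by (auto simp: S_def)
      ultimately have "fst z = 0" using e by (smt (verit) mult_pos_pos powr_gt_zero)
      then have "z = 0" using eq by (simp add: prod_eq_iff)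
      then show False using that by (auto simp: S_def E_def)
    qed
    then show ?thesis unfolding D_def using abs_powr_midpoint_less[OF p] by simp
  qed
  have Dnn: "0 \<le> D z" for z
    unfolding D_def using abs_powr_midpoint_less[OF p, of "fst z" "snd z"]
    by (cases "fst z = snd z") auto
  have "\<exists>C\<ge>0. \<forall>z\<in>S. E z \<le> C * D z"
  proof (cases "S = {}")
    case False
    have "continuous_on S (\<lambda>z. E z / D z)"
      using continuous_on_subset[OF contD, of S] continuous_on_subset[OF contE, of S] Dpos
      by (intro continuous_intros) force+
    from continuous_attains_sup[OF \<open>compact S\<close> False this]
    obtain z0 where z0: "z0 \<in> S" "\<And>z. z \<in> S \<Longrightarrow> E z / D z \<le> E z0 / D z0" by blast
    have "E z \<le> (E z0 / D z0) * D z" if "z \<in> S" for z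
      using z0(2)[OF that] Dpos[of z] that by (simp add: pos_divide_le_eq)
    moreover have "0 \<le> E z0 / D z0" using z0 Dpos[of z0] by (simp add: S_def)
    ultimately show ?thesis by blast
  qed auto
  then obtain C where C: "0 \<le> C" "\<And>z. z \<in> S \<Longrightarrow> E z \<le> C * D z" by blast
  have "E z \<le> C * D z" for z
  proof (cases "0 < E z")
    case True
    then have "z \<noteq> 0" by (auto simp: E_def)
    define r where "r = norm z"
    have r: "0 < r" using \<open>z \<noteq> 0\<close> by (simp add: r_def)
    define w where "w = (1 / r) *\<^sub>R z"
    have z: "z = r *\<^sub>R w" using r by (simp add: w_def)
    have "\<bar>r * x\<bar> powr p = r powr p * \<bar>x\<bar> powr p" for x
      using r by (simp add: abs_mult powr_mult)
    from this[of "fst w"] this[of "snd w"] this[of "fst w - snd w"] this[of "(fst w + snd w) / 2"]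
    have hom: "E z = r powr p * E w" "D z = r powr p * D w"
      by (simp_all add: z E_def D_def algebra_simps add_divide_distrib)
    have "0 < E w"
      using True r unfolding hom(1) by (simp add: zero_less_mult_iff)
    moreover have "norm w = 1"
      using r by (simp add: w_def r_def)
    ultimately have "w \<in> S"
      by (simp add: S_def)
    then have "E w \<le> C * D w" by (rule C(2))
    then have "r powr p * E w \<le> r powr p * (C * D w)" by (intro mult_left_mono) auto
    then show ?thesis using hom by (simp add: algebra_simps)
  next
    case False
    then show ?thesis using C(1) Dnn[of z] by (smt (verit) mult_nonneg_nonneg)
  qed
  then have "\<bar>a - b\<bar> powr p \<le> e * (\<bar>a\<bar> powr p + \<bar>b\<bar> powr p)
        + C * ((\<bar>a\<bar> powr p + \<bar>b\<bar> powr p) / 2 - \<bar>(a + b) / 2\<bar> powr p)" for a b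
    using \<open>\<And>z. E z \<le> C * D z\<close>[of "(a, b)"] by (simp add: E_def D_def)
  with C(1) show thesis by (rule that)
qed

text \<open>Each of \<open>x, y, z\<close> is bounded below by the tangent of the exponential at \<open>L = ln (x powr a * y powr b * z powr c)\<close>;
the weighted sum of the three tangents has value \<open>exp L\<close>.\<close>
lemma weighted_AM_GM3:
  fixes x y z a b c :: real
  assumes "0 < a" "0 < b" "0 < c" "a + b + c = 1" "0 \<le> x" "0 \<le> y" "0 \<le> z"
  shows "x powr a * y powr b * z powr c \<le> a * x + b * y + c * z"
proof (cases "x = 0 \<or> y = 0 \<or> z = 0")
  case True
  then show ?thesis using assms by auto
next
  case False
  then have pos: "0 < x" "0 < y" "0 < z" using assms by auto
  define L where "L = a * ln x + b * ln y + c * ln z"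
  have le: "exp L * (1 + ln t - L) \<le> t" if "0 < t" for t
  proof -
    have "exp L * (1 + (ln t - L)) \<le> exp L * exp (ln t - L)"
      by (intro mult_left_mono exp_ge_add_one_self) auto
    also have "\<dots> = t" using that by (simp add: mult_exp_exp)
    finally show ?thesis by (simp add: add_diff_eq)
  qed
  have "a * (exp L * (1 + ln x - L)) + b * (exp L * (1 + ln y - L)) + c * (exp L * (1 + ln z - L))
      \<le> a * x + b * y + c * z"
    using assms by (intro add_mono mult_left_mono le pos) auto
  also have "a * (exp L * (1 + ln x - L)) + b * (exp L * (1 + ln y - L)) + c * (exp L * (1 + ln z - L))
      = exp L * ((a + b + c) * (1 - L) + L)"
    by (simp add: L_def algebra_simps)
  also have "\<dots> = exp L" using assms by simp
  also have "\<dots> = x powr a * y powr b * z powr c"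
    using pos by (simp add: L_def powr_def exp_add)
  finally show ?thesis .
qed

section \<open>The spaces \<open>L\<^sup>p\<close>: triangle inequality, uniform convexity, completeness\<close>

text \<open>A real-valued version of \<^const>\<open>Lp_norm\<close>; the two agree on \<^const>\<open>Lp_space\<close>.\<close>
definition Lnorm :: "real \<Rightarrow> 'a measure \<Rightarrow> ('a \<Rightarrow> real) \<Rightarrow> real" where
  "Lnorm p M f = (LINT x|M. \<bar>f x\<bar> powr p) powr (1 / p)"

lemma Lp_space_iff:
  "f \<in> Lp_space p M \<longleftrightarrow> f \<in> borel_measurable M \<and> integrable M (\<lambda>x. \<bar>f x\<bar> powr p)"
  by (auto simp: Lp_space_def Lp_norm_def Let_def integrable_iff_bounded top.not_eq_extremum)

lemma Lp_norm_eq_Lnorm: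
  assumes "f \<in> Lp_space p M"
  shows "Lp_norm p M f = ennreal (Lnorm p M f)"
proof -
  have "(\<integral>\<^sup>+ x. ennreal (\<bar>f x\<bar> powr p) \<partial>M) = ennreal (LINT x|M. \<bar>f x\<bar> powr p)"
    using assms by (intro nn_integral_eq_integral) (auto simp: Lp_space_iff)
  then show ?thesis by (simp add: Lp_norm_def Lnorm_def Let_def)
qed

lemma Lp_space_measurable [measurable_dest]: "f \<in> Lp_space p M \<Longrightarrow> f \<in> borel_measurable M"
  by (simp add: Lp_space_def)

lemma Lp_space_integrable: "f \<in> Lp_space p M \<Longrightarrow> integrable M (\<lambda>x. \<bar>f x\<bar> powr p)"
  by (simp add: Lp_space_iff)

lemma Lnorm_nonneg [simp]: "0 \<le> Lnorm p M f"
  by (simp add: Lnorm_def)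

lemma Lnorm_powr: "0 < p \<Longrightarrow> Lnorm p M f powr p = (LINT x|M. \<bar>f x\<bar> powr p)"
  by (simp add: Lnorm_def powr_powr)


lemma powr_le_powr_iff:
  fixes a b p :: real
  assumes "0 < p" "0 \<le> a" "0 \<le> b"
  shows "a powr p \<le> b powr p \<longleftrightarrow> a \<le> b"
  using assms powr_mono2[of p a b] powr_less_mono2[of p b a] by fastforce

lemma Lnorm_le_iff:
  assumes "0 < p" "0 \<le> c"
  shows "Lnorm p M f \<le> c \<longleftrightarrow> (LINT x|M. \<bar>f x\<bar> powr p) \<le> c powr p"
  unfolding Lnorm_powr[OF assms(1), symmetric]
  using assms by (simp add: powr_le_powr_iff)

lemma Lp_space_dominated:
  assumes "0 < p" "g \<in> Lp_space p M" "f \<in> borel_measurable M" "AE x in M. \<bar>f x\<bar> \<le> \<bar>g x\<bar>"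
  shows "f \<in> Lp_space p M"
proof -
  have [measurable]: "f \<in> borel_measurable M" by fact
  have "integrable M (\<lambda>x. \<bar>f x\<bar> powr p)"
  proof (rule Bochner_Integration.integrable_bound[OF Lp_space_integrable[OF assms(2)]])
    show "AE x in M. norm (\<bar>f x\<bar> powr p) \<le> norm (\<bar>g x\<bar> powr p)"
      using assms(4) by eventually_elim (use assms(1) in \<open>auto intro!: powr_mono2\<close>)
  qed measurable
  then show ?thesis using assms(3) by (simp add: Lp_space_iff)
qed

lemma Lnorm_mono:
  assumes "0 < p" "g \<in> Lp_space p M" "f \<in> borel_measurable M" "AE x in M. \<bar>f x\<bar> \<le> \<bar>g x\<bar>"
  shows "Lnorm p M f \<le> Lnorm p M g"
proof -
  have "f \<in> Lp_space p M" by (rule Lp_space_dominated[OF assms])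
  then have "(LINT x|M. \<bar>f x\<bar> powr p) \<le> (LINT x|M. \<bar>g x\<bar> powr p)"
  proof (intro integral_mono_AE Lp_space_integrable assms(2))
    show "AE x in M. \<bar>f x\<bar> powr p \<le> \<bar>g x\<bar> powr p"
      using assms(4) by eventually_elim (use assms(1) in \<open>auto intro!: powr_mono2\<close>)
  qed
  then show ?thesis using assms(1) by (simp add: Lnorm_le_iff Lnorm_powr)
qed

lemma Lnorm_cong_AE:
  assumes "f \<in> borel_measurable M" "g \<in> borel_measurable M" "AE x in M. f x = g x"
  shows "Lnorm p M f = Lnorm p M g"
proof -
  have [measurable]: "f \<in> borel_measurable M" "g \<in> borel_measurable M" by fact+
  have "(LINT x|M. \<bar>f x\<bar> powr p) = (LINT x|M. \<bar>g x\<bar> powr p)"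
  proof (rule integral_cong_AE)
    show "AE x in M. \<bar>f x\<bar> powr p = \<bar>g x\<bar> powr p" using assms(3) by eventually_elim simp
  qed measurable
  then show ?thesis by (simp add: Lnorm_def)
qed

lemma Lp_space_add:
  assumes "1 < p" "f \<in> Lp_space p M" "g \<in> Lp_space p M"
  shows "(\<lambda>x. f x + g x) \<in> Lp_space p M"
proof -
  have [measurable]: "f \<in> borel_measurable M" "g \<in> borel_measurable M"
    using assms by (auto dest: Lp_space_measurable)
  have "integrable M (\<lambda>x. \<bar>f x + g x\<bar> powr p)"
  proof (rule Bochner_Integration.integrable_bound)
    show "integrable M (\<lambda>x. 2 powr p * (\<bar>f x\<bar> powr p + \<bar>g x\<bar> powr p))"
      using assms by (auto dest: Lp_space_integrable)
    show "AE x in M. norm (\<bar>f x + g x\<bar> powr p) \<le> norm (2 powr p * (\<bar>f x\<bar> powr p + \<bar>g x\<bar> powr p))"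
      using abs_add_powr_le[OF assms(1)] by auto
  qed measurable
  then show ?thesis by (simp add: Lp_space_iff)
qed

lemma Lp_space_cmult:
  assumes "f \<in> Lp_space p M"
  shows "(\<lambda>x. c * f x) \<in> Lp_space p M"
  using assms by (auto simp: Lp_space_iff abs_mult powr_mult)

lemma Lnorm_cmult:
  assumes "0 < p"
  shows "Lnorm p M (\<lambda>x. c * f x) = \<bar>c\<bar> * Lnorm p M f"
  using assms by (simp add: Lnorm_def abs_mult powr_mult powr_powr)

lemma Lp_space_diff:
  assumes "1 < p" "f \<in> Lp_space p M" "g \<in> Lp_space p M"
  shows "(\<lambda>x. f x - g x) \<in> Lp_space p M"
  using Lp_space_add[OF assms(1,2) Lp_space_cmult[OF assms(3), of "-1"]] by simp

lemma Lp_space_indicator: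
  assumes "0 < p" "f \<in> Lp_space p M" "A \<in> sets M"
  shows "(\<lambda>x. indicator A x * f x) \<in> Lp_space p M"
proof (rule Lp_space_dominated[OF assms(1,2)])
  show "(\<lambda>x. indicator A x * f x) \<in> borel_measurable M"
    using assms by (auto dest: Lp_space_measurable)
qed (simp split: split_indicator)

lemma Lnorm_minus_commute: "Lnorm p M (\<lambda>x. f x - g x) = Lnorm p M (\<lambda>x. g x - f x)"
  by (simp add: Lnorm_def abs_minus_commute)

text \<open>Minkowski's inequality: \<open>f + g\<close> is \<open>a + b\<close> times a convex combination of \<open>f / a\<close> and \<open>g / b\<close>, where
\<open>a\<close> and \<open>b\<close> exceed the two norms. The slack \<open>e\<close> keeps \<open>a\<close> and \<open>b\<close> positive.\<close>
lemma Lnorm_triangle: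
  assumes p: "1 < p" and f: "f \<in> Lp_space p M" and g: "g \<in> Lp_space p M"
  shows "Lnorm p M (\<lambda>x. f x + g x) \<le> Lnorm p M f + Lnorm p M g"
proof (rule field_le_epsilon)
  fix e :: real assume "0 < e"
  define a b where "a = Lnorm p M f + e / 2" and "b = Lnorm p M g + e / 2"
  have ab: "0 < a" "0 < b" using \<open>0 < e\<close> by (auto simp: a_def b_def add_nonneg_pos)
  define l where "l = a / (a + b)"
  have l: "0 < l" "l < 1" "1 - l = b / (a + b)" using ab by (auto simp: l_def field_simps)
  have le: "\<bar>f x + g x\<bar> powr p \<le>
      (a + b) powr p * (l * (\<bar>f x\<bar> powr p / a powr p) + (1 - l) * (\<bar>g x\<bar> powr p / b powr p))" for x
  proof -
    have "\<bar>f x + g x\<bar> \<le> (a + b) * (l * (\<bar>f x\<bar> / a) + (1 - l) * (\<bar>g x\<bar> / b))"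
      using ab unfolding l(3) by (simp add: l_def distrib_left abs_triangle_ineq)
    then have "\<bar>f x + g x\<bar> powr p \<le> ((a + b) * (l * (\<bar>f x\<bar> / a) + (1 - l) * (\<bar>g x\<bar> / b))) powr p"
      using p by (intro powr_mono2) auto
    also have "\<dots> = (a + b) powr p * (l * (\<bar>f x\<bar> / a) + (1 - l) * (\<bar>g x\<bar> / b)) powr p"
      using ab l by (intro powr_mult)
    also have "\<dots> \<le> (a + b) powr p * (l * (\<bar>f x\<bar> / a) powr p + (1 - l) * (\<bar>g x\<bar> / b) powr p)"
      using ab l by (intro mult_left_mono powr_convex_combination p) auto
    finally show ?thesis using ab by (simp add: powr_divide)
  qed
  have int: "integrable M (\<lambda>x. \<bar>f x\<bar> powr p)" "integrable M (\<lambda>x. \<bar>g x\<bar> powr p)"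
    using f g by (auto dest: Lp_space_integrable)
  have "(LINT x|M. \<bar>f x + g x\<bar> powr p) \<le> (LINT x|M. (a + b) powr p *
      (l * (\<bar>f x\<bar> powr p / a powr p) + (1 - l) * (\<bar>g x\<bar> powr p / b powr p)))"
    using int le by (intro integral_mono Lp_space_integrable Lp_space_add[OF p f g]) auto
  also have "\<dots> = (a + b) powr p * (l * ((LINT x|M. \<bar>f x\<bar> powr p) / a powr p)
      + (1 - l) * ((LINT x|M. \<bar>g x\<bar> powr p) / b powr p))"
    using int by simp
  also have "\<dots> \<le> (a + b) powr p * (l * 1 + (1 - l) * 1)"
  proof (intro mult_left_mono add_mono)
    have "Lnorm p M f \<le> a" "Lnorm p M g \<le> b" using \<open>0 < e\<close> by (auto simp: a_def b_def)
    then show "(LINT x|M. \<bar>f x\<bar> powr p) / a powr p \<le> 1" "(LINT x|M. \<bar>g x\<bar> powr p) / b powr p \<le> 1"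
      using ab p by (simp_all add: Lnorm_le_iff divide_le_eq)
  qed (use l in auto)
  finally have "(LINT x|M. \<bar>f x + g x\<bar> powr p) \<le> (a + b) powr p" by simp
  then have "Lnorm p M (\<lambda>x. f x + g x) \<le> a + b"
    using p ab by (simp add: Lnorm_le_iff)
  then show "Lnorm p M (\<lambda>x. f x + g x) \<le> Lnorm p M f + Lnorm p M g + e"
    by (simp add: a_def b_def)
qed

lemma Lnorm_triangle_diff:
  assumes "1 < p" "f \<in> Lp_space p M" "g \<in> Lp_space p M"
  shows "Lnorm p M (\<lambda>x. f x - g x) \<le> Lnorm p M f + Lnorm p M g"
  using Lnorm_triangle[OF assms(1,2) Lp_space_cmult[OF assms(3), of "-1"]] assms(1)
  by (simp add: Lnorm_cmult[where c = "-1", simplified])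

lemma Lnorm_le_add_diff:
  assumes "1 < p" "f \<in> Lp_space p M" "g \<in> Lp_space p M"
  shows "Lnorm p M f \<le> Lnorm p M g + Lnorm p M (\<lambda>x. f x - g x)"
  using Lnorm_triangle[OF assms(1,3) Lp_space_diff[OF assms]] by simp

text \<open>Integrating the pointwise inequality bounds the distance of \<open>f\<close> and \<open>g\<close> by the midpoint defect of
the norms.\<close>
lemma uniform_convexity_Lp:
  fixes M :: "'a measure"
  assumes p: "1 < p" and e: "0 < e"
  obtains \<delta> where "0 < \<delta>"
    "\<And>f g. \<lbrakk>f \<in> Lp_space p M; g \<in> Lp_space p M; Lnorm p M f \<le> 1; Lnorm p M g \<le> 1;
       1 - \<delta> \<le> Lnorm p M (\<lambda>x. (f x + g x) / 2)\<rbrakk> \<Longrightarrow> Lnorm p M (\<lambda>x. f x - g x) \<le> e"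
proof -
  define \<eta> where "\<eta> = e powr p / 4"
  have \<eta>: "0 < \<eta>" using e by (simp add: \<eta>_def)
  obtain C where C: "0 \<le> C"
    "\<And>a b :: real. \<bar>a - b\<bar> powr p \<le> \<eta> * (\<bar>a\<bar> powr p + \<bar>b\<bar> powr p)
        + C * ((\<bar>a\<bar> powr p + \<bar>b\<bar> powr p) / 2 - \<bar>(a + b) / 2\<bar> powr p)"
    using uniform_convexity_pointwise[OF p \<eta>] by blast
  \<comment> \<open>The two contributions to the bound below are \<open>2 * \<eta>\<close> and \<open>C * (p * \<delta>)\<close>; together they must stay
      below \<open>e powr p = 4 * \<eta>\<close>.\<close>
  define \<delta> where "\<delta> = min 1 (2 * \<eta> / (p * (C + 1)))"
  have \<delta>: "0 < \<delta>" "\<delta> \<le> 1" using p C(1) \<eta> by (auto simp: \<delta>_def)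
  have "\<delta> \<le> 2 * \<eta> / (p * (C + 1))" by (simp add: \<delta>_def)
  then have "\<delta> * (p * (C + 1)) \<le> 2 * \<eta>" using p C(1) by (simp add: pos_le_divide_eq)
  moreover have "C * (p * \<delta>) \<le> \<delta> * (p * (C + 1))" using p \<delta> by (simp add: algebra_simps)
  ultimately have C\<delta>: "C * (p * \<delta>) \<le> 2 * \<eta>" by linarith
  have tan: "1 - p * \<delta> \<le> (1 - \<delta>) powr p"
    using powr_tangent_less[OF p, of "1 - \<delta>" 1] \<delta> by auto
  show thesis
  proof (rule that[OF \<delta>(1)])
    fix f g assume f: "f \<in> Lp_space p M" and g: "g \<in> Lp_space p M"
      and nf: "Lnorm p M f \<le> 1" and ng: "Lnorm p M g \<le> 1"
      and mid: "1 - \<delta> \<le> Lnorm p M (\<lambda>x. (f x + g x) / 2)"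
    have m: "(\<lambda>x. (f x + g x) / 2) \<in> Lp_space p M"
      using Lp_space_cmult[OF Lp_space_add[OF p f g], of "1 / 2"] by simp
    define F G H where "F = (LINT x|M. \<bar>f x\<bar> powr p)" and "G = (LINT x|M. \<bar>g x\<bar> powr p)"
      and "H = (LINT x|M. \<bar>(f x + g x) / 2\<bar> powr p)"
    note int = Lp_space_integrable[OF f] Lp_space_integrable[OF g] Lp_space_integrable[OF m]
    have FG: "F \<le> 1" "G \<le> 1" using nf ng p by (auto simp: Lnorm_le_iff F_def G_def)
    have "(1 - \<delta>) powr p \<le> Lnorm p M (\<lambda>x. (f x + g x) / 2) powr p"
      using mid \<delta> p by (intro powr_mono2) auto
    then have H: "1 - p * \<delta> \<le> H" using tan p by (simp add: Lnorm_powr H_def)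
    have "(LINT x|M. \<bar>f x - g x\<bar> powr p) \<le> (LINT x|M. \<eta> * (\<bar>f x\<bar> powr p + \<bar>g x\<bar> powr p)
        + C * ((\<bar>f x\<bar> powr p + \<bar>g x\<bar> powr p) / 2 - \<bar>(f x + g x) / 2\<bar> powr p))"
      using int C(2)
      by (intro integral_mono Lp_space_integrable Lp_space_diff[OF p f g] integrable_add
          integrable_mult_right integrable_diff integrable_divide) auto
    also have "\<dots> = \<eta> * (F + G) + C * ((F + G) / 2 - H)"
      unfolding F_def G_def H_def using int
      by (subst Bochner_Integration.integral_add) (auto simp: integral_diff)
    also have "\<dots> \<le> \<eta> * 2 + C * (p * \<delta>)"
    proof (intro add_mono mult_left_mono)
      show "(F + G) / 2 - H \<le> p * \<delta>" using FG H by argo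
    qed (use FG \<eta> C(1) in auto)
    also have "\<dots> \<le> e powr p" using C\<delta> by (simp add: \<eta>_def)
    finally show "Lnorm p M (\<lambda>x. f x - g x) \<le> e" using p e by (simp add: Lnorm_le_iff)
  qed
qed

text \<open>Here \<open>d m n\<close> stands for the distance of the terms with indices \<open>m\<close> and \<open>n\<close> of a Cauchy sequence.\<close>
lemma rapidly_Cauchy_subsequence:
  fixes d :: "nat \<Rightarrow> nat \<Rightarrow> real" and c :: "nat \<Rightarrow> real"
  assumes "\<And>e. 0 < e \<Longrightarrow> \<exists>N. \<forall>m\<ge>N. \<forall>n\<ge>N. d m n < e" and "\<And>n. 0 < c n"
  obtains r where "strict_mono r" "\<And>n m. r n \<le> m \<Longrightarrow> d (r n) m < c n"
proof -
  have "\<forall>j. \<exists>N. \<forall>m\<ge>N. \<forall>n\<ge>N. d m n < c j"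
    using assms by blast
  then obtain N where N: "\<And>j m n. \<lbrakk>N j \<le> m; N j \<le> n\<rbrakk> \<Longrightarrow> d m n < c j"
    by metis
  define r where "r n = (\<Sum>i\<le>n. N i + 1)" for n
  have "strict_mono r" by (auto simp: r_def strict_mono_Suc_iff)
  moreover have "N n \<le> r n" for n by (induction n) (auto simp: r_def)
  ultimately show thesis using N that by (meson order_trans)
qed

text \<open>The Riesz-Fischer theorem. Along a subsequence with \<open>\<parallel>h n\<parallel> \<le> 4\<^sup>-\<^sup>n\<close> for the increments \<open>h n\<close>, the functions
\<open>(2 ^ n * \<bar>h n\<bar>) powr p\<close> have a summable sequence of integrals. So they are bounded in \<open>n\<close> almost
everywhere, which gives a geometric bound on the increments and thus a pointwise limit; Fatou's lemma
shows that it is the limit in \<open>L\<^sup>p\<close>.\<close>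
lemma Lp_complete:
  assumes p: "1 < p" and f: "\<And>n. f n \<in> Lp_space p M"
    and Cauchy: "\<And>e. 0 < e \<Longrightarrow> \<exists>N. \<forall>m\<ge>N. \<forall>n\<ge>N. Lnorm p M (\<lambda>x. f m x - f n x) < e"
  obtains F where "F \<in> Lp_space p M" "(\<lambda>n. Lnorm p M (\<lambda>x. f n x - F x)) \<longlonglongrightarrow> 0"
proof -
  have [measurable]: "f n \<in> borel_measurable M" for n using f by (rule Lp_space_measurable)
  obtain r where r: "strict_mono r" "\<And>n m. r n \<le> m \<Longrightarrow> Lnorm p M (\<lambda>x. f (r n) x - f m x) < (1 / 4) ^ n"
    using rapidly_Cauchy_subsequence[OF Cauchy, of "\<lambda>n. (1 / 4) ^ n"] by auto
  define h where "h n x = f (r n) x - f (r (Suc n)) x" for n x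
  have h: "h n \<in> Lp_space p M" for n
    unfolding h_def by (intro Lp_space_diff p f)
  have [measurable]: "h n \<in> borel_measurable M" for n using h by (rule Lp_space_measurable)
  define w where "w n x = (2 ^ n * \<bar>h n x\<bar>) powr p" for n x
  have [measurable]: "w n \<in> borel_measurable M" for n unfolding w_def by measurable
  have w_int: "(\<integral>\<^sup>+ x. ennreal (w n x) \<partial>M) \<le> ennreal ((1 / 2) ^ n)" for n
  proof -
    have "2 ^ n * Lnorm p M (h n) \<le> 2 ^ n * (1 / 4) ^ n"
      using r(2)[of n "r (Suc n)"] strict_monoD[OF r(1), of n "Suc n"]
      by (intro mult_left_mono) (auto simp: h_def[abs_def])
    also have "(2::real) ^ n * (1 / 4) ^ n = (1 / 2) ^ n"
      by (simp flip: power_mult_distrib)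
    finally have "Lnorm p M (\<lambda>x. 2 ^ n * h n x) \<le> (1 / 2) ^ n"
      using p by (simp add: Lnorm_cmult)
    then have "(LINT x|M. w n x) \<le> ((1 / 2) ^ n) powr p"
      using p by (simp add: Lnorm_le_iff w_def abs_mult)
    also have "\<dots> \<le> ((1 / 2) ^ n) powr 1"
      using p by (intro powr_mono') (auto simp: power_le_one)
    also have "\<dots> = (1 / 2) ^ n" by simp
    finally have le: "(LINT x|M. w n x) \<le> (1 / 2) ^ n" .
    have "integrable M (w n)"
      using Lp_space_integrable[OF Lp_space_cmult[OF h, of "2 ^ n" n]]
      by (simp add: w_def[abs_def] abs_mult)
    then have "(\<integral>\<^sup>+ x. ennreal (w n x) \<partial>M) = ennreal (LINT x|M. w n x)"
      by (rule nn_integral_eq_integral) (simp add: w_def)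
    then show ?thesis using ennreal_leI[OF le] by (simp only:)
  qed
  have "(\<integral>\<^sup>+ x. (\<Sum>n. ennreal (w n x)) \<partial>M) = (\<Sum>n. \<integral>\<^sup>+ x. ennreal (w n x) \<partial>M)"
    by (rule nn_integral_suminf) measurable
  also have "\<dots> \<le> (\<Sum>n. ennreal ((1 / 2) ^ n))"
    by (intro suminf_le w_int) auto
  also have "\<dots> = ennreal (\<Sum>n. (1 / 2) ^ n)"
    by (intro suminf_ennreal2) (auto intro: summable_geometric)
  finally have "(\<integral>\<^sup>+ x. (\<Sum>n. ennreal (w n x)) \<partial>M) < \<infinity>"
    by (rule order_le_less_trans) simp
  then have "AE x in M. (\<Sum>n. ennreal (w n x)) \<noteq> \<infinity>"
    by (intro nn_integral_PInf_AE) auto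
  then have conv: "AE x in M. convergent (\<lambda>n. f (r n) x)"
  proof eventually_elim
    case (elim x)
    then obtain B where B: "0 \<le> B" "(\<Sum>n. ennreal (w n x)) = ennreal B"
      by (cases "\<Sum>n. ennreal (w n x)") auto
    have "ennreal (w n x) \<le> ennreal B" for n
      using sum_le_suminf[of "\<lambda>n. ennreal (w n x)" "{n}"] B(2) by simp
    then have wB: "w n x \<le> B" for n
      using B(1) ennreal_le_iff by blast
    have hB: "norm (h n x) \<le> B powr (1 / p) * (1 / 2) ^ n" for n
    proof -
      have "w n x powr (1 / p) \<le> B powr (1 / p)"
        using p wB[of n] by (intro powr_mono2) (auto simp: w_def)
      then have "2 ^ n * \<bar>h n x\<bar> \<le> B powr (1 / p)"
        using p by (simp add: w_def powr_powr)
      then have "\<bar>h n x\<bar> \<le> B powr (1 / p) / 2 ^ n"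
        by (subst pos_le_divide_eq) (auto simp: mult.commute)
      then show ?thesis by (simp add: power_one_over)
    qed
    have "summable (\<lambda>n. B powr (1 / p) * (1 / 2) ^ n)"
      by (intro summable_mult summable_geometric) simp
    then have "summable (\<lambda>n. h n x)"
      by (rule summable_comparison_test') (rule hB)
    then have "convergent (\<lambda>n. \<Sum>i<n. h i x)" by (simp add: summable_iff_convergent)
    then have "convergent (\<lambda>n. f (r 0) x - (\<Sum>i<n. h i x))"
      by (intro convergent_diff convergent_const)
    moreover have "(\<lambda>n. f (r 0) x - (\<Sum>i<n. h i x)) = (\<lambda>n. f (r n) x)"
      unfolding h_def sum_lessThan_telescope'[of "\<lambda>i. f (r i) x"] by simp
    ultimately show ?case by (simp only:)
  qed
  define F where "F x = lim (\<lambda>n. f (r n) x)" for x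
  have [measurable]: "F \<in> borel_measurable M" unfolding F_def by measurable
  have close: "(\<lambda>x. f n x - F x) \<in> Lp_space p M \<and> Lnorm p M (\<lambda>x. f n x - F x) \<le> e"
    if e: "0 < e" and N: "\<forall>m\<ge>N. \<forall>n\<ge>N. Lnorm p M (\<lambda>x. f m x - f n x) < e" and n: "N \<le> n" for e N n
  proof -
    have "(\<integral>\<^sup>+ x. ennreal (\<bar>f n x - F x\<bar> powr p) \<partial>M)
        \<le> (\<integral>\<^sup>+ x. liminf (\<lambda>k. ennreal (\<bar>f n x - f (r k) x\<bar> powr p)) \<partial>M)"
    proof (rule nn_integral_mono_AE, use conv in eventually_elim)
      fix x assume "convergent (\<lambda>n. f (r n) x)"
      then have "(\<lambda>k. f (r k) x) \<longlonglongrightarrow> F x" by (simp add: F_def convergent_LIMSEQ_iff)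
      then have "(\<lambda>k. ennreal (\<bar>f n x - f (r k) x\<bar> powr p)) \<longlonglongrightarrow> ennreal (\<bar>f n x - F x\<bar> powr p)"
        using p by (intro tendsto_ennrealI tendsto_powr' tendsto_intros) auto
      then show "ennreal (\<bar>f n x - F x\<bar> powr p) \<le> liminf (\<lambda>k. ennreal (\<bar>f n x - f (r k) x\<bar> powr p))"
        by (intro eq_refl lim_imp_Liminf[symmetric]) simp_all
    qed
    also have "\<dots> \<le> liminf (\<lambda>k. \<integral>\<^sup>+ x. ennreal (\<bar>f n x - f (r k) x\<bar> powr p) \<partial>M)"
      by (rule nn_integral_liminf) measurable
    also have "\<dots> \<le> ennreal (e powr p)"
    proof (rule Liminf_le)
      have "\<forall>\<^sub>F k in sequentially. N \<le> r k"
        using filterlim_subseq[OF r(1)] by (auto simp: filterlim_at_top)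
      then show "\<forall>\<^sub>F k in sequentially. (\<integral>\<^sup>+ x. ennreal (\<bar>f n x - f (r k) x\<bar> powr p) \<partial>M) \<le> ennreal (e powr p)"
      proof eventually_elim
        case (elim k)
        then have "Lnorm p M (\<lambda>x. f n x - f (r k) x) \<le> e" using N n by (auto simp: less_imp_le)
        then have "(LINT x|M. \<bar>f n x - f (r k) x\<bar> powr p) \<le> e powr p"
          using p e by (simp add: Lnorm_le_iff)
        then show ?case
          using Lp_space_integrable[OF Lp_space_diff[OF p f f, of n "r k"]]
          by (subst nn_integral_eq_integral) (auto intro!: ennreal_leI)
      qed
    qed simp
    finally have le: "(\<integral>\<^sup>+ x. ennreal (\<bar>f n x - F x\<bar> powr p) \<partial>M) \<le> ennreal (e powr p)" .
    then have in_Lp: "(\<lambda>x. f n x - F x) \<in> Lp_space p M"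
      by (auto simp: Lp_space_iff integrable_iff_bounded intro: order_le_less_trans)
    with le have "(LINT x|M. \<bar>f n x - F x\<bar> powr p) \<le> e powr p"
      by (subst (asm) nn_integral_eq_integral) (auto dest: Lp_space_integrable)
    then show ?thesis using in_Lp p e by (simp add: Lnorm_le_iff)
  qed
  obtain N1 where "\<forall>m\<ge>N1. \<forall>n\<ge>N1. Lnorm p M (\<lambda>x. f m x - f n x) < 1" using Cauchy[of 1] by auto
  from close[OF _ this order_refl] have "(\<lambda>x. f N1 x - F x) \<in> Lp_space p M" by simp
  from Lp_space_diff[OF p f[of N1] this] have F: "F \<in> Lp_space p M" by simp
  have "(\<lambda>n. Lnorm p M (\<lambda>x. f n x - F x)) \<longlonglongrightarrow> 0"
  proof (rule LIMSEQ_I)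
    fix e :: real assume "0 < e"
    then obtain N where "\<forall>m\<ge>N. \<forall>n\<ge>N. Lnorm p M (\<lambda>x. f m x - f n x) < e / 2" using Cauchy[of "e / 2"] by auto
    from close[OF _ this] \<open>0 < e\<close>
    show "\<exists>N. \<forall>n\<ge>N. norm (Lnorm p M (\<lambda>x. f n x - F x) - 0) < e" by force
  qed
  with F show thesis by (rule that)
qed

section \<open>Hoelder's and Young's inequalities\<close>

text \<open>Hoelder's inequality for three factors: after division of \<open>x, y, z\<close> by their integrals this is the
integrated arithmetic-geometric mean inequality.\<close>
lemma Holder3:
  fixes x y z w :: "'a \<Rightarrow> real"
  assumes abc: "0 < a" "0 < b" "0 < c" "a + b + c = 1"
    and int: "integrable M x" "integrable M y" "integrable M z"
    and nn: "\<And>t. 0 \<le> x t" "\<And>t. 0 \<le> y t" "\<And>t. 0 \<le> z t"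
    and w [measurable]: "w \<in> borel_measurable M"
    and le: "\<And>t. \<bar>w t\<bar> \<le> x t powr a * y t powr b * z t powr c"
  shows "integrable M w \<and> (LINT t|M. \<bar>w t\<bar>)
    \<le> (LINT t|M. x t) powr a * (LINT t|M. y t) powr b * (LINT t|M. z t) powr c"
proof -
  define X Y Z where "X = (LINT t|M. x t)" and "Y = (LINT t|M. y t)" and "Z = (LINT t|M. z t)"
  have XYZ: "0 \<le> X" "0 \<le> Y" "0 \<le> Z" using nn by (auto simp: X_def Y_def Z_def)
  show ?thesis
  proof (cases "X = 0 \<or> Y = 0 \<or> Z = 0")
    case True
    then have "(AE t in M. x t = 0) \<or> (AE t in M. y t = 0) \<or> (AE t in M. z t = 0)"
      using int nn by (simp add: X_def Y_def Z_def integral_nonneg_eq_0_iff_AE)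
    moreover have "w t = 0" if "x t = 0 \<or> y t = 0 \<or> z t = 0" for t
      using that le[of t] by auto
    ultimately have "AE t in M. w t = 0" by (auto elim!: eventually_mono)
    moreover from this have "integrable M w" by (subst integrable_cong_AE[where g = "\<lambda>_. 0"]) auto
    ultimately show ?thesis
      using XYZ by (simp add: integral_eq_zero_AE eventually_mono flip: X_def Y_def Z_def)
  next
    case False
    then have pos: "0 < X" "0 < Y" "0 < Z" using XYZ by auto
    define P where "P = X powr a * Y powr b * Z powr c"
    define u where "u t = P * (a * (x t / X) + b * (y t / Y) + c * (z t / Z))" for t
    have le_u: "\<bar>w t\<bar> \<le> u t" for t
    proof -
      have "\<bar>w t\<bar> \<le> P * ((x t / X) powr a * (y t / Y) powr b * (z t / Z) powr c)"
        using le[of t] pos nn by (simp add: P_def powr_divide)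
      also have "\<dots> \<le> u t"
        unfolding u_def using pos nn abc by (intro mult_left_mono weighted_AM_GM3) (auto simp: P_def)
      finally show ?thesis .
    qed
    have u: "integrable M u" unfolding u_def using int by auto
    have w_int: "integrable M w"
      using le_u by (intro Bochner_Integration.integrable_bound[OF u]) (auto intro: order_trans[OF _ abs_ge_self])
    then have "(LINT t|M. \<bar>w t\<bar>) \<le> (LINT t|M. u t)"
      using u le_u by (intro integral_mono) auto
    also have "\<dots> = P * (a * (X / X) + b * (Y / Y) + c * (Z / Z))"
      unfolding u_def X_def Y_def Z_def using int by simp
    also have "\<dots> = P" using pos abc by simp
    finally show ?thesis using w_int by (simp add: P_def X_def Y_def Z_def)
  qed
qed

text \<open>The exponents for which correlation maps \<open>L\<^sup>p \<times> L\<^sup>s\<close> to \<open>L\<^sup>q\<close>.\<close>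
locale Young_exponents =
  fixes p q s :: real
  assumes p: "1 < p" and pq: "p < q" and s: "0 < s" and Young_relation: "1 / p + 1 / s = 1 + 1 / q"
begin

lemma q: "1 < q" and q_pos: "0 < q" and p_pos: "0 < p"
  using p pq by auto

lemma s_gt_1: "1 < s"
proof -
  have "1 / q < 1 / p" using p pq by (simp add: frac_less2)
  then have "1 / s < 1" using Young_relation by linarith
  then show ?thesis using s by (simp add: divide_less_eq)
qed

lemma qp_pos: "0 < q / p - 1" and qs_pos: "0 < q / s - 1"
proof -
  show "0 < q / p - 1" using p pq by (simp add: field_simps)
  have "1 / s = 1 + 1 / q - 1 / p" using Young_relation by simp
  then have "q * (1 / s) = q * (1 + 1 / q - 1 / p)" by (rule arg_cong)
  then have "q / s = q * (1 + 1 / q - 1 / p)" by simp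
  also have "\<dots> = 1 + q * (1 - 1 / p)" using q by (simp add: algebra_simps)
  finally have "q / s - 1 = q * (1 - 1 / p)" by simp
  moreover have "0 < q * (1 - 1 / p)" using p pq by (intro mult_pos_pos) auto
  ultimately show "0 < q / s - 1" by simp
qed

text \<open>The part of the proof of Young's inequality that takes place at a fixed point: Hoelder's inequality for
\<open>\<bar>f K\<bar> = (\<bar>f\<bar>\<^sup>p \<bar>K\<bar>\<^sup>s)\<^sup>1\<^sup>/\<^sup>q (\<bar>f\<bar>\<^sup>p)\<^sup>1\<^sup>/\<^sup>p\<^sup>-\<^sup>1\<^sup>/\<^sup>q (\<bar>K\<bar>\<^sup>s)\<^sup>1\<^sup>/\<^sup>s\<^sup>-\<^sup>1\<^sup>/\<^sup>q\<close>. It is stated separately because the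
second factor will be used for functions cut off to a window.\<close>
lemma Young_pointwise:
  assumes f: "f \<in> Lp_space p M" and K: "K \<in> Lp_space s M"
    and fK: "integrable M (\<lambda>t. \<bar>f t\<bar> powr p * \<bar>K t\<bar> powr s)"
  shows "integrable M (\<lambda>t. f t * K t)"
    and "\<bar>LINT t|M. f t * K t\<bar> powr q \<le> (LINT t|M. \<bar>f t\<bar> powr p * \<bar>K t\<bar> powr s)
      * (LINT t|M. \<bar>f t\<bar> powr p) powr (q / p - 1) * (LINT t|M. \<bar>K t\<bar> powr s) powr (q / s - 1)"
proof -
  have [measurable]: "f \<in> borel_measurable M" "K \<in> borel_measurable M"
    using f K by (auto dest: Lp_space_measurable)
  define D A B where "D = (LINT t|M. \<bar>f t\<bar> powr p * \<bar>K t\<bar> powr s)"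
    and "A = (LINT t|M. \<bar>f t\<bar> powr p)" and "B = (LINT t|M. \<bar>K t\<bar> powr s)"
  have nn: "0 \<le> D" "0 \<le> A" "0 \<le> B" by (auto simp: D_def A_def B_def)
  have "1 / q < 1 / p" using p pq by (simp add: frac_less2)
  moreover have "1 / q < 1 / s" using qs_pos q_pos s by (simp add: field_simps)
  ultimately have exps: "0 < 1 / q" "0 < 1 / p - 1 / q" "0 < 1 / s - 1 / q"
      "1 / q + (1 / p - 1 / q) + (1 / s - 1 / q) = 1"
    using q_pos Young_relation by auto
  have "\<bar>f t * K t\<bar> \<le> (\<bar>f t\<bar> powr p * \<bar>K t\<bar> powr s) powr (1 / q)
      * (\<bar>f t\<bar> powr p) powr (1 / p - 1 / q) * (\<bar>K t\<bar> powr s) powr (1 / s - 1 / q)" for t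
    using p_pos s q_pos
    by (cases "f t = 0 \<or> K t = 0") (auto simp: powr_mult powr_powr abs_mult algebra_simps powr_diff)
  from Holder3[OF exps fK Lp_space_integrable[OF f] Lp_space_integrable[OF K] _ _ _ _ this]
  have H: "integrable M (\<lambda>t. f t * K t)"
    "(LINT t|M. \<bar>f t * K t\<bar>) \<le> D powr (1 / q) * A powr (1 / p - 1 / q) * B powr (1 / s - 1 / q)"
    by (auto simp: D_def A_def B_def)
  show "integrable M (\<lambda>t. f t * K t)" by (rule H(1))
  from order_trans[OF integral_abs_bound H(2)] have "\<bar>LINT t|M. f t * K t\<bar> powr q
      \<le> (D powr (1 / q) * A powr (1 / p - 1 / q) * B powr (1 / s - 1 / q)) powr q"
    using q_pos by (intro powr_mono2) auto
  also have "\<dots> = D * A powr (q / p - 1) * B powr (q / s - 1)"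
    using nn q_pos by (simp add: powr_mult powr_powr left_diff_distrib)
  finally show "\<bar>LINT t|M. f t * K t\<bar> powr q \<le> D * A powr (q / p - 1) * B powr (q / s - 1)" .
qed

end

section \<open>Correlation operators on the line\<close>

text \<open>Correlation rather than convolution, since the operator under study integrates \<open>f\<close> over radii larger than \<open>r\<close>.\<close>
definition conv :: "(real \<Rightarrow> real) \<Rightarrow> (real \<Rightarrow> real) \<Rightarrow> real \<Rightarrow> real" where
  "conv K f t = (LINT v|lborel. f (t + v) * K v)"

lemma borel_measurable_conv [measurable]:
  assumes [measurable]: "f \<in> borel_measurable borel" "K \<in> borel_measurable borel"
  shows "conv K f \<in> borel_measurable borel"
proof -
  have "(\<lambda>t. LINT v|lborel. f (t + v) * K v) \<in> borel_measurable lborel"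
    by (rule sigma_finite_measure.borel_measurable_lebesgue_integral[OF sigma_finite_lborel]) measurable
  then show ?thesis by (simp add: conv_def[abs_def])
qed

lemma conv_translate: "conv K (\<lambda>u. f (c + u)) t = conv K f (c + t)"
  by (simp add: conv_def add.assoc)

lemma Lp_space_translate:
  fixes f :: "real \<Rightarrow> real"
  assumes "f \<in> Lp_space p lborel"
  shows "(\<lambda>u. f (c + u)) \<in> Lp_space p lborel"
proof -
  have [measurable]: "f \<in> borel_measurable borel" using Lp_space_measurable[OF assms] by simp
  show ?thesis
    using lborel_integrable_real_affine[OF Lp_space_integrable[OF assms], of 1 c]
    by (simp add: Lp_space_iff)
qed

lemma Lnorm_translate:
  fixes f :: "real \<Rightarrow> real"
  shows "Lnorm p lborel (\<lambda>u. f (c + u)) = Lnorm p lborel f"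
  using lborel_integral_real_affine[of 1 "\<lambda>x. \<bar>f x\<bar> powr p" c] by (simp add: Lnorm_def)

lemma conv_cmult: "conv K (\<lambda>u. c * f u) t = c * conv K f t"
  by (simp add: conv_def mult.assoc)

lemma Tonelli_conv:
  fixes a b :: "real \<Rightarrow> real"
  assumes a: "integrable lborel a" "\<And>x. 0 \<le> a x" and b: "integrable lborel b" "\<And>x. 0 \<le> b x"
  shows "AE t in lborel. integrable lborel (\<lambda>v. a (t + v) * b v)"
    and "integrable lborel (\<lambda>t. LINT v|lborel. a (t + v) * b v)"
    and "(LINT t|lborel. LINT v|lborel. a (t + v) * b v) = (LINT t|lborel. a t) * (LINT v|lborel. b v)"
proof -
  have [measurable]: "a \<in> borel_measurable borel" "b \<in> borel_measurable borel"
    using a b by (auto dest: borel_measurable_integrable)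
  have at: "integrable lborel (\<lambda>t. a (t + v))" "(LINT t|lborel. a (t + v)) = (LINT t|lborel. a t)" for v
    using lborel_integrable_real_affine[OF a(1), of 1 v] lborel_integral_real_affine[of 1 a v]
    by (simp_all add: add.commute)
  let ?F = "\<lambda>(v, t). a (t + v) * b v"
  have F: "integrable (lborel \<Otimes>\<^sub>M lborel) ?F"
  proof (rule lborel_pair.Fubini_integrable)
    show "integrable lborel (\<lambda>v. LINT t|lborel. norm (?F (v, t)))"
      using a b at by simp
    show "AE v in lborel. integrable lborel (\<lambda>t. ?F (v, t))"
      using at by simp
  qed measurable
  have G: "integrable (lborel \<Otimes>\<^sub>M lborel) (\<lambda>(t, v). a (t + v) * b v)"
    using lborel_pair.integrable_product_swap[OF F] by simp
  show "AE t in lborel. integrable lborel (\<lambda>v. a (t + v) * b v)"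
    using lborel_pair.AE_integrable_fst'[OF G] by simp
  show "integrable lborel (\<lambda>t. LINT v|lborel. a (t + v) * b v)"
    using lborel_pair.integrable_fst'[OF G] by simp
  have "(LINT t|lborel. LINT v|lborel. a (t + v) * b v) = (LINT v|lborel. LINT t|lborel. a (t + v) * b v)"
    using lborel_pair.Fubini_integral[OF F] by simp
  also have "\<dots> = (LINT t|lborel. a t) * (LINT v|lborel. b v)"
    using at by simp
  finally show "(LINT t|lborel. LINT v|lborel. a (t + v) * b v) = (LINT t|lborel. a t) * (LINT v|lborel. b v)" .
qed

context Young_exponents
begin

text \<open>A local form of Young's inequality. If the kernel lives on \<open>W\<close>, then the value of \<open>conv K f\<close> at \<open>t\<close> depends
only on \<open>f\<close> restricted to \<open>t + W\<close>, so the factor \<open>\<parallel>f\<parallel>\<^sup>q\<^sup>-\<^sup>p\<close> of the usual bound can be replaced by a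
power of the largest mass \<open>m\<close> in a translate of \<open>W\<close>. With \<open>W\<close> the whole line this is Young's inequality;
with \<open>W\<close> bounded it excludes vanishing, because \<open>q / p - 1 > 0\<close>.\<close>
lemma conv_window_bound:
  assumes f: "f \<in> Lp_space p lborel" and K: "K \<in> Lp_space s lborel"
    and window: "\<And>v. v \<notin> W \<Longrightarrow> K v = 0" "W \<in> sets borel"
    and mass: "\<And>t. (LINT v|lborel. indicator W v * \<bar>f (t + v)\<bar> powr p) \<le> m" and m: "0 \<le> m"
  shows "AE t in lborel. integrable lborel (\<lambda>v. f (t + v) * K v)"
    and "conv K f \<in> Lp_space q lborel"
    and "Lnorm q lborel (conv K f) powr q
      \<le> Lnorm p lborel f powr p * Lnorm s lborel K powr q * m powr (q / p - 1)"
proof -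
  have [measurable]: "f \<in> borel_measurable borel" "K \<in> borel_measurable borel" "W \<in> sets borel"
    using f K window by (auto dest: Lp_space_measurable)
  let ?D = "\<lambda>t. LINT v|lborel. \<bar>f (t + v)\<bar> powr p * \<bar>K v\<bar> powr s"
  define B where "B = (LINT v|lborel. \<bar>K v\<bar> powr s)"
  define C where "C = m powr (q / p - 1) * B powr (q / s - 1)"
  have B: "0 \<le> B" by (simp add: B_def)
  have C: "0 \<le> C" by (simp add: C_def)
  note T = Tonelli_conv[OF Lp_space_integrable[OF f] _ Lp_space_integrable[OF K]]
  have "AE t in lborel. integrable lborel (\<lambda>v. \<bar>f (t + v)\<bar> powr p * \<bar>K v\<bar> powr s)"
    using T(1) by simp
  then have pt: "AE t in lborel. integrable lborel (\<lambda>v. f (t + v) * K v) \<and> \<bar>conv K f t\<bar> powr q \<le> C * ?D t"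
  proof eventually_elim
    case (elim t)
    define g where "g v = indicator W v * f (t + v)" for v
    have g: "g \<in> Lp_space p lborel"
      unfolding g_def by (intro Lp_space_indicator p_pos Lp_space_translate f) simp
    have eqs: "\<bar>g v\<bar> powr p * \<bar>K v\<bar> powr s = \<bar>f (t + v)\<bar> powr p * \<bar>K v\<bar> powr s"
      "g v * K v = f (t + v) * K v"
      "\<bar>g v\<bar> powr p = indicator W v * \<bar>f (t + v)\<bar> powr p" for v
      using window(1)[of v] s p by (auto simp: g_def split: split_indicator)
    note Y = Young_pointwise[OF g K, unfolded eqs(1,2), OF elim, unfolded eqs(3)]
    have "\<bar>conv K f t\<bar> powr q \<le> ?D t
        * (LINT v|lborel. indicator W v * \<bar>f (t + v)\<bar> powr p) powr (q / p - 1) * B powr (q / s - 1)"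
      using Y(2) by (simp add: conv_def B_def)
    also have "\<dots> \<le> ?D t * m powr (q / p - 1) * B powr (q / s - 1)"
      using qp_pos by (intro mult_right_mono mult_left_mono powr_mono2 mass) auto
    finally show ?case using Y(1) by (simp add: C_def mult_ac)
  qed
  then show "AE t in lborel. integrable lborel (\<lambda>v. f (t + v) * K v)"
    by eventually_elim simp
  have D_int: "integrable lborel (\<lambda>t. C * ?D t)"
    using T(2) by simp
  have "integrable lborel (\<lambda>t. \<bar>conv K f t\<bar> powr q)"
  proof (rule Bochner_Integration.integrable_bound[OF D_int])
    show "AE t in lborel. norm (\<bar>conv K f t\<bar> powr q) \<le> norm (C * ?D t)"
      using pt by eventually_elim (auto intro: order_trans[OF _ abs_ge_self])
  qed measurable
  then show conv: "conv K f \<in> Lp_space q lborel"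
    by (simp add: Lp_space_iff)
  have "(LINT t|lborel. \<bar>conv K f t\<bar> powr q) \<le> (LINT t|lborel. C * ?D t)"
    using pt by (intro integral_mono_AE Lp_space_integrable[OF conv] D_int) auto
  also have "\<dots> = C * ((LINT t|lborel. \<bar>f t\<bar> powr p) * B)"
    using T(3) by (simp add: B_def)
  also have "\<dots> = (LINT t|lborel. \<bar>f t\<bar> powr p) * (B powr (q / s - 1) * B powr 1) * m powr (q / p - 1)"
    using B by (simp add: C_def)
  also have "B powr (q / s - 1) * B powr 1 = B powr (q / s - 1 + 1)"
    by (rule powr_add[symmetric])
  also have "\<dots> = (B powr (1 / s)) powr q"
    by (simp add: powr_powr)
  finally show "Lnorm q lborel (conv K f) powr q
      \<le> Lnorm p lborel f powr p * Lnorm s lborel K powr q * m powr (q / p - 1)"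
    by (simp add: Lnorm_powr p_pos q_pos) (simp add: Lnorm_def B_def)
qed

lemma
  assumes f: "f \<in> Lp_space p lborel" and K: "K \<in> Lp_space s lborel"
  shows AE_conv_integrable: "AE t in lborel. integrable lborel (\<lambda>v. f (t + v) * K v)"
    and conv_in_Lq: "conv K f \<in> Lp_space q lborel"
    and Young_inequality: "Lnorm q lborel (conv K f) \<le> Lnorm p lborel f * Lnorm s lborel K"
proof -
  let ?A = "Lnorm p lborel f" and ?B = "Lnorm s lborel K"
  have mass: "(LINT v|lborel. indicator UNIV v * \<bar>f (t + v)\<bar> powr p) \<le> ?A powr p" for t
    using Lnorm_powr[OF p_pos, of lborel "\<lambda>v. f (t + v)"] by (simp add: Lnorm_translate)
  note bound = conv_window_bound[OF f K _ _ mass, simplified]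
  show "AE t in lborel. integrable lborel (\<lambda>v. f (t + v) * K v)" "conv K f \<in> Lp_space q lborel"
    by (rule bound(1), rule bound(2))
  have "Lnorm q lborel (conv K f) powr q \<le> ?A powr p * ?B powr q * (?A powr p) powr (q / p - 1)"
    by (rule bound(3))
  also have "\<dots> = (?A * ?B) powr q"
    using p_pos by (simp add: powr_mult powr_powr right_diff_distrib flip: powr_add)
  finally show "Lnorm q lborel (conv K f) \<le> ?A * ?B"
    using q_pos by (simp add: powr_le_powr_iff)
qed

lemma AE_conv_add:
  assumes "f \<in> Lp_space p lborel" "g \<in> Lp_space p lborel" "K \<in> Lp_space s lborel"
  shows "AE t in lborel. conv K (\<lambda>u. f u + g u) t = conv K f t + conv K g t"
  using AE_conv_integrable[OF assms(1,3)] AE_conv_integrable[OF assms(2,3)]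
  by eventually_elim (simp add: conv_def distrib_right)

lemma AE_conv_diff:
  assumes "f \<in> Lp_space p lborel" "g \<in> Lp_space p lborel" "K \<in> Lp_space s lborel"
  shows "AE t in lborel. conv K (\<lambda>u. f u - g u) t = conv K f t - conv K g t"
  using AE_conv_integrable[OF assms(1,3)] AE_conv_integrable[OF assms(2,3)]
  by eventually_elim (simp add: conv_def left_diff_distrib)

lemma AE_conv_kernel_diff:
  assumes "f \<in> Lp_space p lborel" "K \<in> Lp_space s lborel" "H \<in> Lp_space s lborel"
  shows "AE t in lborel. conv (\<lambda>v. K v - H v) f t = conv K f t - conv H f t"
  using AE_conv_integrable[OF assms(1,2)] AE_conv_integrable[OF assms(1,3)]
  by eventually_elim (simp add: conv_def right_diff_distrib)

end

section \<open>Concentration of nearly extremal functions\<close>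

definition mass :: "real \<Rightarrow> (real \<Rightarrow> real) \<Rightarrow> real set \<Rightarrow> real" where
  "mass p f S = (LINT u|lborel. indicator S u * \<bar>f u\<bar> powr p)"

definition cut :: "real set \<Rightarrow> (real \<Rightarrow> real) \<Rightarrow> real \<Rightarrow> real" where
  "cut S f u = indicator S u * f u"

lemma cut_in_Lp:
  assumes "0 < p" "f \<in> Lp_space p lborel" "S \<in> sets borel"
  shows "cut S f \<in> Lp_space p lborel"
  using Lp_space_indicator[of p f lborel S] assms by (simp add: cut_def[abs_def])

lemma Lnorm_cut_powr: "0 < p \<Longrightarrow> Lnorm p lborel (cut S f) powr p = mass p f S"
  unfolding Lnorm_powr mass_def
  by (intro Bochner_Integration.integral_cong) (auto simp: cut_def split: split_indicator)

lemma mass_nonneg [simp]: "0 \<le> mass p f S"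
  by (simp add: mass_def)

lemma mass_integrable:
  assumes "f \<in> Lp_space p lborel" "S \<in> sets borel"
  shows "integrable lborel (\<lambda>u. indicator S u * \<bar>f u\<bar> powr p)"
  using integrable_mult_indicator[of S lborel "\<lambda>u. \<bar>f u\<bar> powr p"] assms
  by (auto dest: Lp_space_integrable)

lemma mass_mono:
  assumes "f \<in> Lp_space p lborel" "S \<in> sets borel" "T \<in> sets borel" "S \<subseteq> T"
  shows "mass p f S \<le> mass p f T"
  unfolding mass_def using assms
  by (intro integral_mono mass_integrable) (auto split: split_indicator)

lemma mass_Un_disjoint:
  assumes "f \<in> Lp_space p lborel" "S \<in> sets borel" "T \<in> sets borel" "S \<inter> T = {}"
  shows "mass p f (S \<union> T) = mass p f S + mass p f T"
  unfolding mass_def using assms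
  by (subst Bochner_Integration.integral_add[symmetric])
    (auto intro!: mass_integrable Bochner_Integration.integral_cong split: split_indicator)

lemma mass_le_1:
  assumes "0 < p" "f \<in> Lp_space p lborel" "S \<in> sets borel" "Lnorm p lborel f \<le> 1"
  shows "mass p f S \<le> 1"
proof -
  have "mass p f S \<le> mass p f UNIV" using assms by (intro mass_mono) auto
  also have "\<dots> = Lnorm p lborel f powr p" using assms(1) by (simp add: mass_def Lnorm_powr)
  also have "\<dots> \<le> 1 powr p" using assms by (intro powr_mono2) auto
  finally show ?thesis by simp
qed

lemma mass_translate:
  "mass p (\<lambda>u. f (c + u)) S = mass p f ((\<lambda>u. c + u) ` S)"
proof -
  have "mass p f ((\<lambda>u. c + u) ` S) = (LINT u|lborel. indicator ((\<lambda>u. c + u) ` S) (c + u) * \<bar>f (c + u)\<bar> powr p)"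
    using lborel_integral_real_affine[of 1 "\<lambda>u. indicator ((\<lambda>u. c + u) ` S) u * \<bar>f u\<bar> powr p" c]
    by (simp add: mass_def)
  moreover have "indicator ((\<lambda>u. c + u) ` S) (c + u) = (indicator S u :: real)" for u
    by (auto simp: indicator_def)
  ultimately show ?thesis by (simp add: mass_def)
qed

text \<open>The strict inequality behind the exclusion of dichotomy: for \<open>r > 1\<close> and \<open>m > 0\<close>, splitting a unit of
mass into two parts that are both at least \<open>m\<close> decreases the sum of \<open>r\<close>-th powers by a definite amount.\<close>
lemma sum_powr_le:
  fixes a b m r :: real
  assumes "1 < r" "0 \<le> m" "m \<le> a" "m \<le> b" "a + b \<le> 1"
  shows "a powr r + b powr r \<le> (1 - m) powr (r - 1)"
proof -
  have le: "x powr r \<le> x * (1 - m) powr (r - 1)" if "0 \<le> x" "x \<le> 1 - m" for x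
  proof -
    have "x powr r = x * x powr (r - 1)"
      using that assms(1) powr_mult_base[of x "r - 1"] by simp
    then show ?thesis using that assms(1) by (simp add: mult_left_mono powr_mono2)
  qed
  have "a powr r + b powr r \<le> a * (1 - m) powr (r - 1) + b * (1 - m) powr (r - 1)"
    using assms by (intro add_mono le) auto
  also have "\<dots> = (a + b) * (1 - m) powr (r - 1)" by (simp add: distrib_right)
  also have "\<dots> \<le> 1 * (1 - m) powr (r - 1)" using assms by (intro mult_right_mono) auto
  finally show ?thesis by simp
qed

context Young_exponents
begin

lemma Lnorm_conv_diff:
  assumes f: "f \<in> Lp_space p lborel" and g: "g \<in> Lp_space p lborel" and K: "K \<in> Lp_space s lborel"
  shows "Lnorm q lborel (\<lambda>t. conv K f t - conv K g t) = Lnorm q lborel (conv K (\<lambda>u. f u - g u))"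
proof (rule Lnorm_cong_AE)
  show "(\<lambda>t. conv K f t - conv K g t) \<in> borel_measurable lborel"
    using Lp_space_diff[OF q conv_in_Lq[OF f K] conv_in_Lq[OF g K]] by (rule Lp_space_measurable)
  show "conv K (\<lambda>u. f u - g u) \<in> borel_measurable lborel"
    using conv_in_Lq[OF Lp_space_diff[OF p f g] K] by (rule Lp_space_measurable)
qed (use AE_conv_diff[OF f g K] in eventually_elim, simp)

lemma Lnorm_conv_kernel_diff:
  assumes f: "f \<in> Lp_space p lborel" and K: "K \<in> Lp_space s lborel" and H: "H \<in> Lp_space s lborel"
  shows "Lnorm q lborel (\<lambda>t. conv K f t - conv H f t)
    \<le> Lnorm p lborel f * Lnorm s lborel (\<lambda>v. K v - H v)"
proof -
  have KH: "(\<lambda>v. K v - H v) \<in> Lp_space s lborel" by (rule Lp_space_diff[OF s_gt_1 K H])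
  have "Lnorm q lborel (\<lambda>t. conv K f t - conv H f t) = Lnorm q lborel (conv (\<lambda>v. K v - H v) f)"
  proof (rule Lnorm_cong_AE)
    show "(\<lambda>t. conv K f t - conv H f t) \<in> borel_measurable lborel"
      using Lp_space_diff[OF q conv_in_Lq[OF f K] conv_in_Lq[OF f H]] by (rule Lp_space_measurable)
    show "conv (\<lambda>v. K v - H v) f \<in> borel_measurable lborel"
      using conv_in_Lq[OF f KH] by (rule Lp_space_measurable)
  qed (use AE_conv_kernel_diff[OF f K H] in eventually_elim, simp)
  then show ?thesis using Young_inequality[OF f KH] by simp
qed

end

text \<open>The kernel is a limit in \<open>L\<^sup>s\<close> of continuous kernels with compact support. All estimates
below are made for such an approximation; by Young's inequality the error is small in operator norm.
The constant \<open>A\<close> bounds the operator norm, and the existence of the sequences considered later makes it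
sharp.\<close>
locale extremal_kernel = Young_exponents +
  fixes K :: "real \<Rightarrow> real" and A :: real
  assumes K: "K \<in> Lp_space s lborel"
    and approx: "\<And>e. 0 < e \<Longrightarrow> \<exists>H L. 0 < L \<and> continuous_on UNIV H \<and> (\<forall>v. L < \<bar>v\<bar> \<longrightarrow> H v = 0)
      \<and> H \<in> Lp_space s lborel \<and> Lnorm s lborel (\<lambda>v. K v - H v) \<le> e"
    and A_pos: "0 < A"
    and A_bound: "\<And>f. f \<in> Lp_space p lborel \<Longrightarrow> Lnorm q lborel (conv K f) \<le> A * Lnorm p lborel f"
begin

text \<open>If every window of length \<open>2 L\<close> had mass at most \<open>c\<close>, then \<open>\<parallel>conv H f\<parallel>\<^sup>q \<le> \<parallel>H\<parallel>\<^sup>q c\<^sup>q\<^sup>/\<^sup>p\<^sup>-\<^sup>1\<close>, which for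
small \<open>c\<close> is less than \<open>(A / 4)\<^sup>q\<close>; but \<open>conv H f\<close> differs from \<open>conv K f\<close> by at most \<open>A / 4\<close>.\<close>
lemma window_with_mass:
  obtains L c where "0 < L" "0 < c"
    "\<And>f. \<lbrakk>f \<in> Lp_space p lborel; Lnorm p lborel f \<le> 1; A / 2 \<le> Lnorm q lborel (conv K f)\<rbrakk>
      \<Longrightarrow> \<exists>x. c < mass p f {x - L..x + L}"
proof -
  obtain H L where H: "0 < L" "\<And>v. L < \<bar>v\<bar> \<Longrightarrow> H v = 0" "H \<in> Lp_space s lborel"
      "Lnorm s lborel (\<lambda>v. K v - H v) \<le> A / 4"
    using approx[of "A / 4"] A_pos by auto
  define B where "B = Lnorm s lborel H powr q"
  define c where "c = ((A / 4) powr q / (2 * (B + 1))) powr (1 / (q / p - 1))"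
  have B: "0 \<le> B" by (simp add: B_def)
  have c: "0 < c" using A_pos B by (simp add: c_def)
  have cr: "c powr (q / p - 1) = (A / 4) powr q / (2 * (B + 1))"
    using A_pos B qp_pos pq by (simp add: c_def powr_powr)
  show thesis
  proof (rule that[OF H(1) c], rule ccontr)
    fix f assume f: "f \<in> Lp_space p lborel" and nf: "Lnorm p lborel f \<le> 1"
      and big: "A / 2 \<le> Lnorm q lborel (conv K f)" and no: "\<nexists>x. c < mass p f {x - L..x + L}"
    have window: "(LINT v|lborel. indicator {-L..L} v * \<bar>f (t + v)\<bar> powr p) \<le> c" for t
    proof -
      have "(LINT v|lborel. indicator {-L..L} v * \<bar>f (t + v)\<bar> powr p) = mass p (\<lambda>v. f (t + v)) {-L..L}"
        by (simp add: mass_def)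
      also have "\<dots> = mass p f {t - L..t + L}"
        unfolding mass_translate by (simp add: image_add_atLeastAtMost add.commute)
      also have "\<dots> \<le> c" using no by (simp add: not_less)
      finally show ?thesis .
    qed
    have supp: "H v = 0" if "v \<notin> {-L..L}" for v
      using that by (intro H(2)) auto
    have "Lnorm q lborel (conv K f) \<le> Lnorm q lborel (conv H f) + Lnorm q lborel (\<lambda>t. conv K f t - conv H f t)"
      by (intro Lnorm_le_add_diff q conv_in_Lq f K H)
    also have "Lnorm q lborel (\<lambda>t. conv K f t - conv H f t) \<le> 1 * (A / 4)"
      using H(4) nf by (intro order_trans[OF Lnorm_conv_kernel_diff[OF f K H(3)]] mult_mono) auto
    finally have "A / 4 \<le> Lnorm q lborel (conv H f)" using big by simp
    then have "(A / 4) powr q \<le> Lnorm q lborel (conv H f) powr q"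
      using A_pos q_pos by (intro powr_mono2) auto
    also have "\<dots> \<le> Lnorm p lborel f powr p * B * c powr (q / p - 1)"
      unfolding B_def using c by (intro conv_window_bound(3)[OF f H(3) supp _ window]) auto
    also have "\<dots> \<le> 1 * B * c powr (q / p - 1)"
      using B nf p_pos by (intro mult_right_mono powr_le1) auto
    also have "\<dots> = (A / 4) powr q * (B / (2 * (B + 1)))"
      by (simp add: cr)
    also have "\<dots> < (A / 4) powr q * 1"
      using A_pos B by (intro mult_strict_left_mono) (auto simp: divide_less_eq)
    finally show False by simp
  qed
qed

text \<open>A function with mass \<open>c\<close> near the origin that is nearly extremal cannot have mass \<open>\<epsilon>\<close> far away. Among
\<open>N\<close> consecutive annuli of width \<open>2 L\<close> one has mass at most \<open>1 / N\<close>. Without that annulus, \<open>f\<close> is a sum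
\<open>a + b\<close> of an inner and an outer part; since \<open>H\<close> is supported in \<open>[-L, L]\<close>, the functions \<open>conv H a\<close> and
\<open>conv H b\<close> have disjoint supports, and \<open>sum_powr_le\<close> shows that \<open>a + b\<close> misses the constant \<open>A\<close> by a factor
\<open>\<kappa> < 1\<close> that depends only on \<open>c\<close> and \<open>\<epsilon>\<close>.\<close>
lemma tightness:
  assumes c: "0 < c" and L0: "0 < L0" and \<epsilon>: "0 < \<epsilon>"
  obtains R \<delta> where "0 < R" "0 < \<delta>"
    "\<And>f. \<lbrakk>f \<in> Lp_space p lborel; Lnorm p lborel f \<le> 1; c \<le> mass p f {-L0..L0};
      A - \<delta> \<le> Lnorm q lborel (conv K f)\<rbrakk> \<Longrightarrow> mass p f {v. R < \<bar>v\<bar>} \<le> \<epsilon>"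
proof -
  define m where "m = min (min c \<epsilon>) (1 / 2)"
  define \<theta> where "\<theta> = (1 - m) powr (q / p - 1)"
  define \<kappa> where "\<kappa> = \<theta> powr (1 / q)"
  \<comment> \<open>The errors from replacing \<open>K\<close> by \<open>H\<close> (twice), from the annulus and from \<open>f\<close> itself are at most
      \<open>4 * \<eta>\<close>, half of the loss \<open>A * (1 - \<kappa>)\<close>.\<close>
  define \<eta> where "\<eta> = A * (1 - \<kappa>) / 8"
  have m: "0 < m" "m \<le> c" "m \<le> \<epsilon>" "m < 1" using c \<epsilon> by (auto simp: m_def)
  have \<theta>: "0 \<le> \<theta>" "\<theta> < 1"
    using m qp_pos powr_less_mono2[of "q / p - 1" "1 - m" 1] by (auto simp: \<theta>_def)
  have \<kappa>: "0 \<le> \<kappa>" "\<kappa> < 1" "\<kappa> powr q = \<theta>"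
    using \<theta> q_pos powr_less_mono2[of "1 / q" \<theta> 1] by (auto simp: \<kappa>_def powr_powr)
  have \<eta>: "0 < \<eta>" using A_pos \<kappa> by (simp add: \<eta>_def)
  obtain H L where H: "0 < L" "\<And>v. L < \<bar>v\<bar> \<Longrightarrow> H v = 0" "H \<in> Lp_space s lborel"
      "Lnorm s lborel (\<lambda>v. K v - H v) \<le> \<eta>"
    using approx[of "\<eta>"] \<eta> by auto
  obtain N :: nat where N: "0 < N" "1 / real N < (\<eta> / A) powr p"
    using ex_inverse_of_nat_less[of "(\<eta> / A) powr p"] \<eta> A_pos by (auto simp: inverse_eq_divide)
  define R where "R = L0 + 2 * L * real N"
  have R: "0 < R" using L0 H(1) N by (simp add: R_def add_pos_pos)
  show thesis
  proof (rule that[OF R \<eta>], rule ccontr)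
    fix f assume f: "f \<in> Lp_space p lborel" and nf: "Lnorm p lborel f \<le> 1"
      and center: "c \<le> mass p f {-L0..L0}" and near: "A - \<eta> \<le> Lnorm q lborel (conv K f)"
      and "\<not> mass p f {v. R < \<bar>v\<bar>} \<le> \<epsilon>"
    then have far: "\<epsilon> \<le> mass p f {v. R < \<bar>v\<bar>}" by simp
    note mono = mass_mono[OF f] and le1 = mass_le_1[OF p_pos f _ nf] and Un = mass_Un_disjoint[OF f]
    define G where "G j = mass p f {v. \<bar>v\<bar> \<le> L0 + 2 * L * real j}" for j :: nat
    have "\<exists>j<N. G (Suc j) - G j \<le> 1 / real N"
    proof (rule ccontr)
      assume "\<not> (\<exists>j<N. G (Suc j) - G j \<le> 1 / real N)"
      then have "(\<Sum>j<N. 1 / real N) < (\<Sum>j<N. G (Suc j) - G j)"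
        using N(1) by (intro sum_strict_mono) auto
      also have "\<dots> = G N - G 0" by (rule sum_lessThan_telescope)
      also have "\<dots> \<le> 1"
        using le1[of "{v. \<bar>v\<bar> \<le> L0 + 2 * L * real N}"] mass_nonneg[of p f "{v. \<bar>v\<bar> \<le> L0 + 2 * L * real 0}"]
        unfolding G_def by (simp del: mass_nonneg)
      finally show False using N(1) by simp
    qed
    then obtain j where j: "j < N" "G (Suc j) - G j \<le> 1 / real N" by blast
    define \<rho> where "\<rho> = L0 + 2 * L * real j"
    have "L0 \<le> \<rho>" using H(1) by (simp add: \<rho>_def)
    have "real j + 1 \<le> real N" using j(1) by simp
    then have "2 * L * (real j + 1) \<le> 2 * L * real N" using H(1) by (intro mult_left_mono) auto
    then have "\<rho> + 2 * L \<le> R" by (simp add: \<rho>_def R_def algebra_simps)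
    \<comment> \<open>\<open>Mid\<close> is the annulus of small mass; it has width \<open>2 * L\<close>, so that neither \<open>conv H a\<close> nor \<open>conv H b\<close>
        reaches across its middle \<open>\<rho> + L\<close>.\<close>
    define In Mid Out where "In = {v::real. \<bar>v\<bar> \<le> \<rho>}" and "Mid = {v::real. \<rho> < \<bar>v\<bar> \<and> \<bar>v\<bar> \<le> \<rho> + 2 * L}"
      and "Out = {v::real. \<rho> + 2 * L < \<bar>v\<bar>}"
    have sets [simp]: "In \<in> sets borel" "Mid \<in> sets borel" "Out \<in> sets borel"
      unfolding In_def Mid_def Out_def by measurable
    have "In \<union> Mid = {v. \<bar>v\<bar> \<le> L0 + 2 * L * real (Suc j)}"
      using H(1) by (auto simp: In_def Mid_def \<rho>_def algebra_simps)
    then have "G (Suc j) = mass p f In + mass p f Mid"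
      unfolding G_def by (metis Un[OF sets(1,2)] In_def Mid_def disjoint_iff mem_Collect_eq not_less)
    then have mid: "mass p f Mid \<le> 1 / real N"
      using j(2) by (simp add: G_def In_def \<rho>_def)
    have In: "c \<le> mass p f In"
      by (rule order_trans[OF center mono]) (use \<open>L0 \<le> \<rho>\<close> in \<open>auto simp: In_def\<close>)
    have Out: "\<epsilon> \<le> mass p f Out"
      by (rule order_trans[OF far mono]) (use \<open>\<rho> + 2 * L \<le> R\<close> in \<open>auto simp: Out_def\<close>)
    have InOut: "mass p f In + mass p f Out \<le> 1"
      using Un[OF sets(1,3)] le1[of "In \<union> Out"] H(1) by (auto simp: In_def Out_def disjoint_iff)
    define a b d where "a = cut In f" and "b = cut Out f" and "d = cut Mid f"
    have abd: "a \<in> Lp_space p lborel" "b \<in> Lp_space p lborel" "d \<in> Lp_space p lborel"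
      unfolding a_def b_def d_def by (intro cut_in_Lp p_pos f; simp)+
    define g where "g = (\<lambda>u. a u + b u)"
    have g: "g \<in> Lp_space p lborel" unfolding g_def by (intro Lp_space_add p abd)
    have [measurable]: "f \<in> borel_measurable borel" using Lp_space_measurable[OF f] by simp
    have ng: "Lnorm p lborel g \<le> 1"
    proof (rule order_trans[OF Lnorm_mono[OF p_pos f] nf])
      show "g \<in> borel_measurable lborel" by (rule Lp_space_measurable[OF g])
      show "AE u in lborel. \<bar>g u\<bar> \<le> \<bar>f u\<bar>"
        using H(1) by (auto simp: g_def a_def b_def cut_def In_def Out_def split: split_indicator)
    qed
    have f_eq: "f u - g u = d u" for u
      using H(1) by (auto simp: g_def a_def b_def d_def cut_def In_def Out_def Mid_def split: split_indicator)
    have nd: "A * Lnorm p lborel d \<le> \<eta>"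
    proof -
      have "Lnorm p lborel d powr p \<le> (\<eta> / A) powr p"
        using mid N(2) by (simp add: d_def Lnorm_cut_powr p_pos)
      then have "Lnorm p lborel d \<le> \<eta> / A"
        using \<eta> A_pos p_pos by (simp add: powr_le_powr_iff)
      then show ?thesis using A_pos by (simp add: field_simps)
    qed
    have nH: "Lnorm q lborel (conv H h) \<le> (A + \<eta>) * Lnorm p lborel h" if h: "h \<in> Lp_space p lborel" for h
    proof -
      have "Lnorm q lborel (conv H h) \<le> Lnorm q lborel (conv K h) + Lnorm q lborel (\<lambda>t. conv H h t - conv K h t)"
        by (intro Lnorm_le_add_diff q conv_in_Lq h K H)
      also have "\<dots> \<le> A * Lnorm p lborel h + Lnorm p lborel h * \<eta>"
      proof (intro add_mono A_bound h)
        show "Lnorm q lborel (\<lambda>t. conv H h t - conv K h t) \<le> Lnorm p lborel h * \<eta>"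
          unfolding Lnorm_minus_commute[of q lborel "conv H h"]
          by (intro order_trans[OF Lnorm_conv_kernel_diff[OF h K H(3)]] mult_left_mono H(4)) simp
      qed
      finally show ?thesis by (simp add: algebra_simps)
    qed
    have nH_mass: "(LINT t|lborel. \<bar>conv H (cut S f) t\<bar> powr q) \<le> (A + \<eta>) powr q * mass p f S powr (q / p)"
      if S: "S \<in> sets borel" for S
    proof -
      have "(LINT t|lborel. \<bar>conv H (cut S f) t\<bar> powr q) = Lnorm q lborel (conv H (cut S f)) powr q"
        by (simp add: Lnorm_powr q_pos)
      also have "\<dots> \<le> ((A + \<eta>) * Lnorm p lborel (cut S f)) powr q"
        using q_pos by (intro powr_mono2 nH cut_in_Lp p_pos f S) auto
      also have "\<dots> = (A + \<eta>) powr q * (Lnorm p lborel (cut S f) powr p) powr (q / p)"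
        using A_pos \<eta> p_pos by (simp add: powr_mult powr_powr)
      finally show ?thesis by (simp add: Lnorm_cut_powr p_pos)
    qed
    have a0: "conv H a t = 0" if "\<rho> + L < \<bar>t\<bar>" for t
    proof -
      have "(\<lambda>v. a (t + v) * H v) = (\<lambda>v. 0)"
      proof (rule ext)
        fix v show "a (t + v) * H v = 0"
        using that H(2)[of v] by (auto simp: a_def cut_def In_def split: split_indicator)
      qed
      then show ?thesis unfolding conv_def by (simp only: integral_zero)
    qed
    have b0: "conv H b t = 0" if "\<bar>t\<bar> \<le> \<rho> + L" for t
    proof -
      have "(\<lambda>v. b (t + v) * H v) = (\<lambda>v. 0)"
      proof (rule ext)
        fix v show "b (t + v) * H v = 0"
        using that H(2)[of v] by (auto simp: b_def cut_def Out_def split: split_indicator)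
      qed
      then show ?thesis unfolding conv_def by (simp only: integral_zero)
    qed
    have "(LINT t|lborel. \<bar>conv H g t\<bar> powr q)
        = (LINT t|lborel. \<bar>conv H a t\<bar> powr q + \<bar>conv H b t\<bar> powr q)"
    proof (rule integral_cong_AE)
      show "AE t in lborel. \<bar>conv H g t\<bar> powr q = \<bar>conv H a t\<bar> powr q + \<bar>conv H b t\<bar> powr q"
        using AE_conv_add[OF abd(1,2) H(3)]
      proof eventually_elim
        case (elim t)
        then show ?case
          using a0[of t] b0[of t] by (cases "\<rho> + L < \<bar>t\<bar>") (auto simp: g_def)
      qed
    qed (use conv_in_Lq[OF g H(3)] conv_in_Lq[OF abd(1) H(3)] conv_in_Lq[OF abd(2) H(3)] in measurable)
    also have "\<dots> = (LINT t|lborel. \<bar>conv H a t\<bar> powr q) + (LINT t|lborel. \<bar>conv H b t\<bar> powr q)"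
      by (intro Bochner_Integration.integral_add Lp_space_integrable conv_in_Lq abd H)
    also have "\<dots> \<le> (A + \<eta>) powr q * mass p f In powr (q / p) + (A + \<eta>) powr q * mass p f Out powr (q / p)"
      unfolding a_def b_def by (intro add_mono nH_mass) auto
    also have "\<dots> = (A + \<eta>) powr q * (mass p f In powr (q / p) + mass p f Out powr (q / p))"
      by (simp add: distrib_left)
    also have "\<dots> \<le> (A + \<eta>) powr q * \<theta>"
      unfolding \<theta>_def using In Out InOut m qp_pos by (intro mult_left_mono sum_powr_le) auto
    also have "\<dots> = ((A + \<eta>) * \<kappa>) powr q"
      using A_pos \<eta> \<kappa> by (simp add: powr_mult)
    finally have nHg: "Lnorm q lborel (conv H g) \<le> (A + \<eta>) * \<kappa>"
      using A_pos \<eta> \<kappa> q_pos by (simp add: Lnorm_le_iff)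
    have "Lnorm q lborel (conv K g) \<le> Lnorm q lborel (conv H g) + Lnorm q lborel (\<lambda>t. conv K g t - conv H g t)"
      by (intro Lnorm_le_add_diff q conv_in_Lq g K H)
    also have "Lnorm q lborel (\<lambda>t. conv K g t - conv H g t) \<le> 1 * \<eta>"
      using H(4) ng by (intro order_trans[OF Lnorm_conv_kernel_diff[OF g K H(3)]] mult_mono) auto
    finally have nKg: "Lnorm q lborel (conv K g) \<le> (A + \<eta>) * \<kappa> + \<eta>" using nHg by simp
    have "Lnorm q lborel (conv K f) \<le> Lnorm q lborel (conv K g) + Lnorm q lborel (\<lambda>t. conv K f t - conv K g t)"
      by (intro Lnorm_le_add_diff q conv_in_Lq f g K)
    also have "Lnorm q lborel (\<lambda>t. conv K f t - conv K g t) = Lnorm q lborel (conv K d)"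
      unfolding Lnorm_conv_diff[OF f g K] by (simp add: f_eq)
    also have "\<dots> \<le> \<eta>" using A_bound[OF abd(3)] nd by linarith
    finally have "A - \<eta> \<le> (A + \<eta>) * \<kappa> + \<eta> + \<eta>" using nKg near by linarith
    moreover have "\<eta> * \<kappa> \<le> \<eta> * 1" using \<kappa> \<eta> by (intro mult_left_mono) auto
    ultimately have "A * (1 - \<kappa>) \<le> 4 * \<eta>" by (simp add: algebra_simps)
    then show False using \<eta> by (simp add: \<eta>_def)
  qed
qed

text \<open>Tightness allows one to cut \<open>f n\<close> off to a fixed interval and then to replace \<open>K\<close> by \<open>H\<close>. The resulting
functions \<open>conv H (h n)\<close> vanish outside a fixed interval, are uniformly bounded since \<open>h n\<close> is bounded in \<open>L\<^sup>1\<close>,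
and inherit a common modulus of continuity from \<open>H\<close>. The oscillation of the images along the subsequence
is bounded by a given \<open>e\<close> only; a diagonal argument will remove this.\<close>
lemma conv_compact:
  assumes f: "\<And>n. f n \<in> Lp_space p lborel" and nf: "\<And>n. Lnorm p lborel (f n) \<le> 1"
    and tight: "\<And>\<epsilon>. 0 < \<epsilon> \<Longrightarrow> \<exists>R. \<forall>\<^sub>F n in sequentially. mass p (f n) {v. R < \<bar>v\<bar>} \<le> \<epsilon>"
    and e: "0 < e"
  obtains r :: "nat \<Rightarrow> nat" where "strict_mono r"
    "\<And>i j. Lnorm q lborel (\<lambda>t. conv K (f (r i)) t - conv K (f (r j)) t) \<le> e"
proof -
  have [measurable]: "f n \<in> borel_measurable borel" for n using Lp_space_measurable[OF f[of n]] by simp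
  obtain H L where H: "0 < L" "continuous_on UNIV H" "\<And>v. L < \<bar>v\<bar> \<Longrightarrow> H v = 0" "H \<in> Lp_space s lborel"
      "Lnorm s lborel (\<lambda>v. K v - H v) \<le> e / 8"
    using approx[of "e / 8"] e by auto
  have [measurable]: "H \<in> borel_measurable borel" using Lp_space_measurable[OF H(4)] by simp
  have "0 < (e / (8 * A)) powr p" using e A_pos by simp
  from tight[OF this] obtain R0 n0
    where R0: "\<And>n. n0 \<le> n \<Longrightarrow> mass p (f n) {v. R0 < \<bar>v\<bar>} \<le> (e / (8 * A)) powr p"
    unfolding eventually_sequentially by blast
  define R where "R = max R0 1"
  have R: "0 < R" "R0 \<le> R" by (auto simp: R_def)
  define h where "h n = cut {-R..R} (f (n + n0))" for n
  have h: "h n \<in> Lp_space p lborel" for n unfolding h_def by (intro cut_in_Lp p_pos f) simp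
  have [measurable]: "h n \<in> borel_measurable borel" for n using Lp_space_measurable[OF h[of n]] by simp
  have nh: "Lnorm p lborel (h n) \<le> 1" for n
  proof (rule order_trans[OF Lnorm_mono[OF p_pos f] nf[of "n + n0"]])
    show "h n \<in> borel_measurable lborel" by simp
    show "AE u in lborel. \<bar>h n u\<bar> \<le> \<bar>f (n + n0) u\<bar>"
      by (simp add: h_def cut_def split: split_indicator)
  qed
  have close: "Lnorm q lborel (\<lambda>t. conv K (f (n + n0)) t - conv H (h n) t) \<le> e / 4" for n
  proof -
    let ?f = "f (n + n0)"
    have "Lnorm p lborel (\<lambda>u. ?f u - h n u) powr p = Lnorm p lborel (cut {v. R < \<bar>v\<bar>} ?f) powr p"
      by (intro arg_cong2[where f = "(powr)"] arg_cong[where f = "Lnorm p lborel"])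
        (auto simp: h_def cut_def fun_eq_iff split: split_indicator)
    also have "\<dots> \<le> mass p ?f {v. R0 < \<bar>v\<bar>}"
      unfolding Lnorm_cut_powr[OF p_pos] using R by (intro mass_mono[OF f]) auto
    also have "\<dots> \<le> (e / (8 * A)) powr p" by (rule R0) simp
    finally have "Lnorm p lborel (\<lambda>u. ?f u - h n u) \<le> e / (8 * A)"
      using e A_pos p_pos by (simp add: powr_le_powr_iff)
    then have "A * Lnorm p lborel (\<lambda>u. ?f u - h n u) \<le> e / 8"
      using A_pos by (simp add: field_simps)
    with A_bound[OF Lp_space_diff[OF p f[of "n + n0"] h[of n]]]
    have 1: "Lnorm q lborel (\<lambda>t. conv K ?f t - conv K (h n) t) \<le> e / 8"
      unfolding Lnorm_conv_diff[OF f h K] by linarith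
    have "Lnorm q lborel (\<lambda>t. conv K (h n) t - conv H (h n) t) \<le> 1 * (e / 8)"
      using H(5) nh by (intro order_trans[OF Lnorm_conv_kernel_diff[OF h K H(4)]] mult_mono) auto
    then show ?thesis
      using 1 Lnorm_triangle[OF q Lp_space_diff[OF q conv_in_Lq[OF f[of "n + n0"] K] conv_in_Lq[OF h[of n] K]]
          Lp_space_diff[OF q conv_in_Lq[OF h[of n] K] conv_in_Lq[OF h[of n] H(4)]]]
      by simp
  qed
  have h_le: "\<bar>h n u\<bar> \<le> indicator {-R..R} u + \<bar>f (n + n0) u\<bar> powr p" for n u
  proof -
    have "y \<le> 1 + y powr p" if "0 \<le> y" for y :: real
      using powr_mono[of 1 p y] p that by (cases "1 \<le> y") (auto simp: add_increasing2)
    then show ?thesis by (auto simp: h_def cut_def split: split_indicator)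
  qed
  have Icc_int: "integrable lborel (indicator {-a..a} :: real \<Rightarrow> real)" if "0 < a" for a :: real
    using that by (intro integrable_real_indicator) auto
  have bd_int: "integrable lborel (\<lambda>u. indicator {-R..R} u + \<bar>f (n + n0) u\<bar> powr p)" for n
    using Lp_space_integrable[OF f] R(1) by (intro Bochner_Integration.integrable_add Icc_int) auto
  have h_int: "integrable lborel (h n)" for n
    by (rule Bochner_Integration.integrable_bound[OF bd_int[of n]])
      (use h_le in auto)
  define C where "C = 2 * R + 1"
  have C: "0 < C" using R by (simp add: C_def)
  have h_L1: "(LINT u|lborel. \<bar>h n u\<bar>) \<le> C" for n
  proof -
    have "(LINT u|lborel. \<bar>h n u\<bar>) \<le> (LINT u|lborel. indicator {-R..R} u + \<bar>f (n + n0) u\<bar> powr p)"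
      using h_int h_le by (intro integral_mono bd_int) auto
    also have "\<dots> = 2 * R + (LINT u|lborel. \<bar>f (n + n0) u\<bar> powr p)"
      using R Icc_int[OF R(1)] Lp_space_integrable[OF f] by (subst Bochner_Integration.integral_add) auto
    also have "(LINT u|lborel. \<bar>f (n + n0) u\<bar> powr p) \<le> 1"
      using nf[of "n + n0"] p_pos by (simp add: Lnorm_le_iff)
    finally show ?thesis by (simp add: C_def)
  qed
  have "bounded (H ` {-L..L})"
    using H(2) by (intro compact_imp_bounded compact_continuous_image continuous_on_subset[OF H(2)]) auto
  then obtain B where B: "\<And>v. v \<in> {-L..L} \<Longrightarrow> \<bar>H v\<bar> \<le> B"
    unfolding bounded_iff by force
  have B0: "0 \<le> B" using B[of 0] H(1) by force
  have HB: "\<bar>H v\<bar> \<le> B" for v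
  proof (cases "L < \<bar>v\<bar>")
    case False
    then have "v \<in> {-L..L}" by auto
    then show ?thesis by (rule B)
  qed (simp add: H(3) B0)
  have hH_int: "integrable lborel (\<lambda>u. h n u * H (u - t))" for n t
  proof (rule Bochner_Integration.integrable_bound[of _ "\<lambda>u. h n u * B"])
    show "AE u in lborel. norm (h n u * H (u - t)) \<le> norm (h n u * B)"
      using HB B0 by (auto simp: abs_mult intro!: mult_left_mono)
  qed (use h_int in auto)
  have conv_H: "conv H (h n) t = (LINT u|lborel. h n u * H (u - t))" for n t
    using lborel_integral_real_affine[of 1 "\<lambda>u. h n u * H (u - t)" t] by (simp add: conv_def)
  have bounded: "norm (conv H (h n) t) \<le> C * B" for n t
  proof -
    have "\<bar>conv H (h n) t\<bar> \<le> (LINT u|lborel. \<bar>h n u * H (u - t)\<bar>)"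
      unfolding conv_H by (rule integral_abs_bound)
    also have "\<dots> \<le> (LINT u|lborel. \<bar>h n u\<bar> * B)"
    proof (rule integral_mono)
      show "integrable lborel (\<lambda>u. \<bar>h n u * H (u - t)\<bar>)" using hH_int by (rule integrable_abs)
      show "\<bar>h n u * H (u - t)\<bar> \<le> \<bar>h n u\<bar> * B" for u
        using HB by (simp add: abs_mult mult_left_mono)
    qed (use h_int in auto)
    also have "\<dots> \<le> C * B" using h_L1 B0 by (simp add: mult_right_mono)
    finally show ?thesis by simp
  qed
  define S where "S = {-(R + L)..R + L}"
  have equicont: "\<exists>d>0. \<forall>n y. y \<in> S \<and> norm (x - y) < d \<longrightarrow> norm (conv H (h n) x - conv H (h n) y) < \<epsilon>"
    if x: "x \<in> S" and \<epsilon>: "0 < \<epsilon>" for x \<epsilon>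
  proof -
    have "uniformly_continuous_on {-(2 * R + L)..2 * R + L} H"
      by (intro compact_uniformly_continuous continuous_on_subset[OF H(2)]) auto
    then obtain d where d: "0 < d" "\<And>v w. \<lbrakk>v \<in> {-(2 * R + L)..2 * R + L}; w \<in> {-(2 * R + L)..2 * R + L}; dist w v < d\<rbrakk>
        \<Longrightarrow> dist (H w) (H v) < \<epsilon> / (2 * C)"
      unfolding uniformly_continuous_on_def using \<epsilon> C by (metis divide_pos_pos mult_pos_pos zero_less_numeral)
    show ?thesis
    proof (intro exI[of _ d] conjI allI impI d(1))
      fix n y assume y: "y \<in> S \<and> norm (x - y) < d"
      have pt: "\<bar>h n u * H (u - x) - h n u * H (u - y)\<bar> \<le> \<bar>h n u\<bar> * (\<epsilon> / (2 * C))" for u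
      proof (cases "u \<in> {-R..R}")
        case True
        then have "dist (H (u - x)) (H (u - y)) < \<epsilon> / (2 * C)"
          using x y by (intro d(2)) (auto simp: S_def dist_real_def)
        then show ?thesis
          unfolding right_diff_distrib[symmetric] abs_mult dist_real_def
          by (intro mult_left_mono) auto
      qed (simp add: h_def cut_def)
      have "\<bar>conv H (h n) x - conv H (h n) y\<bar> = \<bar>LINT u|lborel. h n u * H (u - x) - h n u * H (u - y)\<bar>"
        unfolding conv_H using hH_int by simp
      also have "\<dots> \<le> (LINT u|lborel. \<bar>h n u * H (u - x) - h n u * H (u - y)\<bar>)"
        by (rule integral_abs_bound)
      also have "\<dots> \<le> (LINT u|lborel. \<bar>h n u\<bar> * (\<epsilon> / (2 * C)))"
        using hH_int h_int pt by (intro integral_mono) auto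
      also have "\<dots> \<le> C * (\<epsilon> / (2 * C))"
        using h_L1 \<epsilon> C by (subst integral_mult_left_zero) (intro mult_right_mono, auto)
      also have "\<dots> < \<epsilon>" using C \<epsilon> by simp
      finally show "norm (conv H (h n) x - conv H (h n) y) < \<epsilon>" by simp
    qed
  qed
  obtain g k where k: "strict_mono (k :: nat \<Rightarrow> nat)"
    and unif: "\<And>\<epsilon>. 0 < \<epsilon> \<Longrightarrow> \<exists>N. \<forall>n x. n \<ge> N \<and> x \<in> S \<longrightarrow> norm (conv H (h (k n)) x - g x) < \<epsilon>"
    using Arzela_Ascoli[of S "\<lambda>n. conv H (h n)" "C * B"] bounded equicont unfolding S_def
    by (metis compact_Icc)
  define l where "l = 2 * (R + L)"
  have l: "0 < l" using R H(1) by (simp add: l_def)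
  \<comment> \<open>Functions supported in \<open>S\<close> and bounded by \<open>2 * \<eta>\<close> have norm at most \<open>2 * \<eta> * l powr (1 / q) = e / 2\<close>.\<close>
  define \<eta> where "\<eta> = e / 4 / l powr (1 / q)"
  have \<eta>: "0 < \<eta>" using e l by (simp add: \<eta>_def)
  obtain N where N: "\<And>n x. \<lbrakk>N \<le> n; x \<in> S\<rbrakk> \<Longrightarrow> norm (conv H (h (k n)) x - g x) < \<eta>"
    using unif[OF \<eta>] by blast
  have H_close: "Lnorm q lborel (\<lambda>t. conv H (h (k i)) t - conv H (h (k j)) t) \<le> e / 2"
    if ij: "N \<le> i" "N \<le> j" for i j
  proof -
    have off: "conv H (h n) t = 0" if "t \<notin> S" for n t
    proof -
      have "(\<lambda>v. h n (t + v) * H v) = (\<lambda>v. 0)"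
      proof (rule ext)
        fix v show "h n (t + v) * H v = 0"
        using that H(3)[of v] by (cases "L < \<bar>v\<bar>") (auto simp: S_def h_def cut_def split: split_indicator)
      qed
      then show ?thesis unfolding conv_def by (simp only: integral_zero)
    qed
    have pt: "\<bar>conv H (h (k i)) t - conv H (h (k j)) t\<bar> powr q \<le> indicator S t * (2 * \<eta>) powr q" for t
    proof (cases "t \<in> S")
      case True
      then have "\<bar>conv H (h (k i)) t - conv H (h (k j)) t\<bar> \<le> 2 * \<eta>"
        using N[OF ij(1) True] N[OF ij(2) True] by simp
      then show ?thesis using True q_pos by (simp add: powr_mono2)
    qed (simp add: off)
    have "(LINT t|lborel. \<bar>conv H (h (k i)) t - conv H (h (k j)) t\<bar> powr q)
        \<le> (LINT t|lborel. indicator S t * (2 * \<eta>) powr q)"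
    proof (intro integral_mono pt)
      show "integrable lborel (\<lambda>t. \<bar>conv H (h (k i)) t - conv H (h (k j)) t\<bar> powr q)"
        by (intro Lp_space_integrable Lp_space_diff q conv_in_Lq h H(4))
      show "integrable lborel (\<lambda>t. indicator S t * (2 * \<eta>) powr q)"
        unfolding S_def using R H(1) by (intro integrable_mult_left Icc_int) auto
    qed
    also have "\<dots> = l * (2 * \<eta>) powr q"
      using R H(1) by (simp add: S_def l_def)
    also have "\<dots> = (e / 2) powr q"
    proof -
      have "2 * \<eta> = (e / 2) / l powr (1 / q)" by (simp add: \<eta>_def)
      then show ?thesis using l e q_pos by (simp add: powr_divide powr_powr powr_mult)
    qed
    finally show ?thesis using q_pos e by (subst Lnorm_le_iff) auto
  qed
  define r where "r i = k (i + N) + n0" for i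
  have "strict_mono r" using k by (simp add: r_def strict_mono_def)
  moreover have "Lnorm q lborel (\<lambda>t. conv K (f (r i)) t - conv K (f (r j)) t) \<le> e" for i j
  proof -
    let ?K = "\<lambda>i. conv K (f (r i))" and ?H = "\<lambda>i. conv H (h (k (i + N)))"
    have in_Lq: "?K i \<in> Lp_space q lborel" "?H i \<in> Lp_space q lborel" for i
      by (intro conv_in_Lq f h K H(4))+
    have "Lnorm q lborel (\<lambda>t. ?K i t - ?K j t)
        = Lnorm q lborel (\<lambda>t. ((?K i t - ?H i t) + (?H i t - ?H j t)) - (?K j t - ?H j t))"
      by simp
    also have "\<dots> \<le> Lnorm q lborel (\<lambda>t. (?K i t - ?H i t) + (?H i t - ?H j t)) + Lnorm q lborel (\<lambda>t. ?K j t - ?H j t)"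
      by (intro Lnorm_triangle_diff Lp_space_add Lp_space_diff q in_Lq)
    also have "Lnorm q lborel (\<lambda>t. (?K i t - ?H i t) + (?H i t - ?H j t))
        \<le> Lnorm q lborel (\<lambda>t. ?K i t - ?H i t) + Lnorm q lborel (\<lambda>t. ?H i t - ?H j t)"
      by (intro Lnorm_triangle Lp_space_diff q in_Lq)
    finally show ?thesis
      using close[of "k (i + N)"] close[of "k (j + N)"] H_close[of "i + N" "j + N"] by (simp add: r_def)
  qed
  ultimately show thesis by (rule that)
qed

text \<open>After translation by \<open>\<tau> n\<close> the sequence is tight, so the images of a subsequence form a Cauchy sequence.
Midpoints of far terms are then nearly extremal as well, and uniform convexity makes the subsequence
a Cauchy sequence itself.\<close>
theorem extremizing_precompact:
  assumes f: "\<And>n. f n \<in> Lp_space p lborel" and nf: "\<And>n. Lnorm p lborel (f n) = 1"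
    and lim: "(\<lambda>n. Lnorm q lborel (conv K (f n))) \<longlonglongrightarrow> A"
  obtains \<phi> :: "nat \<Rightarrow> nat" and \<tau> :: "nat \<Rightarrow> real" and F where "strict_mono \<phi>" "F \<in> Lp_space p lborel"
    "(\<lambda>n. Lnorm p lborel (\<lambda>u. f (\<phi> n) (\<tau> (\<phi> n) + u) - F u)) \<longlonglongrightarrow> 0"
proof -
  obtain L c where Lc: "0 < L" "0 < c"
    "\<And>f. \<lbrakk>f \<in> Lp_space p lborel; Lnorm p lborel f \<le> 1; A / 2 \<le> Lnorm q lborel (conv K f)\<rbrakk>
      \<Longrightarrow> \<exists>x. c < mass p f {x - L..x + L}"
    using window_with_mass by blast
  define \<tau> where "\<tau> n = (SOME x. c < mass p (f n) {x - L..x + L})" for n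
  define g where "g n u = f n (\<tau> n + u)" for n u
  have g: "g n \<in> Lp_space p lborel" for n
    using Lp_space_translate[OF f] by (simp add: g_def[abs_def])
  have ng: "Lnorm p lborel (g n) = 1" for n
    using nf[of n] by (simp add: g_def[abs_def] Lnorm_translate)
  have "Lnorm q lborel (conv K (g n)) = Lnorm q lborel (conv K (f n))" for n
    using Lnorm_translate[of q "conv K (f n)" "\<tau> n"] by (simp add: g_def[abs_def] conv_translate[abs_def])
  with lim have lim_g: "(\<lambda>n. Lnorm q lborel (conv K (g n))) \<longlonglongrightarrow> A" by simp
  have near: "\<forall>\<^sub>F n in sequentially. A - \<delta> \<le> Lnorm q lborel (conv K (g n))" if "0 < \<delta>" for \<delta>
    using order_tendstoD(1)[OF lim_g, of "A - \<delta>"] that by (auto elim: eventually_mono)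
  have center: "\<forall>\<^sub>F n in sequentially. c \<le> mass p (g n) {-L..L}"
  proof -
    have "\<forall>\<^sub>F n in sequentially. A / 2 < Lnorm q lborel (conv K (f n))"
      using order_tendstoD(1)[OF lim, of "A / 2"] A_pos by simp
    then show ?thesis
    proof eventually_elim
      case (elim n)
      have "c < mass p (f n) {\<tau> n - L..\<tau> n + L}"
        unfolding \<tau>_def by (rule someI_ex, rule Lc(3)[OF f]) (use elim nf in auto)
      then show ?case
        unfolding g_def[abs_def] mass_translate by (simp add: image_add_atLeastAtMost add.commute)
    qed
  qed
  have tight: "\<exists>R. \<forall>\<^sub>F n in sequentially. mass p (g n) {v. R < \<bar>v\<bar>} \<le> \<epsilon>" if \<epsilon>: "0 < \<epsilon>" for \<epsilon>
  proof -
    obtain R \<delta> where R: "0 < \<delta>" "\<And>f. \<lbrakk>f \<in> Lp_space p lborel; Lnorm p lborel f \<le> 1; c \<le> mass p f {-L..L};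
      A - \<delta> \<le> Lnorm q lborel (conv K f)\<rbrakk> \<Longrightarrow> mass p f {v. R < \<bar>v\<bar>} \<le> \<epsilon>"
      using tightness[OF Lc(2,1) \<epsilon>] by blast
    have "\<forall>\<^sub>F n in sequentially. mass p (g n) {v. R < \<bar>v\<bar>} \<le> \<epsilon>"
      using near[OF R(1)] center by eventually_elim (use R(2) g ng in auto)
    then show ?thesis ..
  qed
  let ?D = "\<lambda>m n. Lnorm q lborel (\<lambda>t. conv K (g m) t - conv K (g n) t)"
  interpret subseqs "\<lambda>n s. \<forall>i j. ?D (s i) (s j) \<le> 1 / real (Suc n)"
  proof
    fix n and s :: "nat \<Rightarrow> nat" assume s: "strict_mono s"
    have "\<exists>R. \<forall>\<^sub>F i in sequentially. mass p (g (s i)) {v. R < \<bar>v\<bar>} \<le> \<epsilon>" if "0 < \<epsilon>" for \<epsilon>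
      using tight[OF that] eventually_subseq[OF s] by blast
    then obtain r :: "nat \<Rightarrow> nat" where r: "strict_mono r" "\<And>i j. ?D (s (r i)) (s (r j)) \<le> 1 / real (Suc n)"
      using conv_compact[of "\<lambda>i. g (s i)" "1 / real (Suc n)"] g ng by auto
    show "\<exists>r :: nat \<Rightarrow> nat. strict_mono r \<and> (\<forall>i j. ?D ((s \<circ> r) i) ((s \<circ> r) j) \<le> 1 / real (Suc n))"
      using r by (intro exI[of _ r] conjI allI) (simp_all only: o_def)
  qed
  define \<phi> where "\<phi> = diagseq"
  have \<phi>: "strict_mono \<phi>" unfolding \<phi>_def by (rule subseq_diagseq)
  have conv_Cauchy: "\<exists>N. \<forall>i\<ge>N. \<forall>j\<ge>N. ?D (\<phi> i) (\<phi> j) \<le> e" if e: "0 < e" for e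
  proof -
    obtain k where k: "1 / real (Suc k) < e"
      using reals_Archimedean[OF e] by (auto simp: inverse_eq_divide)
    have D: "\<forall>i j. ?D ((diagseq \<circ> (+) (Suc k)) i) ((diagseq \<circ> (+) (Suc k)) j) \<le> 1 / real (Suc k)"
      by (rule diagseq_holds) auto
    have "?D (\<phi> (Suc k + i)) (\<phi> (Suc k + j)) \<le> e" for i j
      using D[rule_format, of i j] k unfolding \<phi>_def o_def by linarith
    then have "?D (\<phi> i) (\<phi> j) \<le> e" if "Suc k \<le> i" "Suc k \<le> j" for i j
      using that by (metis le_add_diff_inverse)
    then show ?thesis by blast
  qed
  have Cauchy: "\<exists>N. \<forall>i\<ge>N. \<forall>j\<ge>N. Lnorm p lborel (\<lambda>u. g (\<phi> i) u - g (\<phi> j) u) < e" if e: "0 < e" for e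
  proof -
    obtain \<delta> where \<delta>: "0 < \<delta>"
      "\<And>f g :: real \<Rightarrow> real. \<lbrakk>f \<in> Lp_space p lborel; g \<in> Lp_space p lborel; Lnorm p lborel f \<le> 1; Lnorm p lborel g \<le> 1;
       1 - \<delta> \<le> Lnorm p lborel (\<lambda>x. (f x + g x) / 2)\<rbrakk> \<Longrightarrow> Lnorm p lborel (\<lambda>x. f x - g x) \<le> e / 2"
      using uniform_convexity_Lp[OF p, of "e / 2" "lborel :: real measure"] e by auto
    have A\<delta>: "0 < A * \<delta>" using A_pos \<delta> by simp
    obtain N1 where N1: "\<And>i j. \<lbrakk>N1 \<le> i; N1 \<le> j\<rbrakk> \<Longrightarrow> ?D (\<phi> i) (\<phi> j) \<le> A * \<delta>"
      using conv_Cauchy[OF A\<delta>] by blast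
    have "\<forall>\<^sub>F i in sequentially. A - A * \<delta> / 2 \<le> Lnorm q lborel (conv K (g (\<phi> i)))"
      using near[of "A * \<delta> / 2"] A\<delta> eventually_subseq[OF \<phi>] by simp
    then obtain N2 where N2: "\<And>i. N2 \<le> i \<Longrightarrow> A - A * \<delta> / 2 \<le> Lnorm q lborel (conv K (g (\<phi> i)))"
      by (auto simp: eventually_sequentially)
    have "Lnorm p lborel (\<lambda>u. g (\<phi> i) u - g (\<phi> j) u) < e" if i: "max N1 N2 \<le> i" and j: "max N1 N2 \<le> j" for i j
    proof -
      let ?i = "\<phi> i" and ?j = "\<phi> j"
      define mid where "mid u = (g ?i u + g ?j u) / 2" for u
      have mid: "mid \<in> Lp_space p lborel"
        using Lp_space_cmult[OF Lp_space_add[OF p g g], of "1 / 2" ?i ?j] by (simp add: mid_def[abs_def])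
      have "(\<lambda>u. g ?i u - mid u) = (\<lambda>u. 1 / 2 * (g ?i u - g ?j u))"
        by (simp add: mid_def field_simps fun_eq_iff)
      then have "Lnorm q lborel (\<lambda>t. conv K (g ?i) t - conv K mid t) = 1 / 2 * ?D ?i ?j"
        unfolding Lnorm_conv_diff[OF g mid K] Lnorm_conv_diff[OF g g K]
        by (simp only: conv_cmult[abs_def] Lnorm_cmult[OF q_pos])
      also have "\<dots> \<le> A * \<delta> / 2" using N1[of i j] i j by simp
      finally have "Lnorm q lborel (conv K (g ?i)) \<le> Lnorm q lborel (conv K mid) + A * \<delta> / 2"
        using Lnorm_le_add_diff[OF q conv_in_Lq[OF g[of ?i] K] conv_in_Lq[OF mid K]] by linarith
      then have "A - A * \<delta> \<le> Lnorm q lborel (conv K mid)" using N2[of i] i by simp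
      also have "\<dots> \<le> A * Lnorm p lborel mid" by (rule A_bound[OF mid])
      finally have "A * (1 - \<delta>) \<le> A * Lnorm p lborel mid" by (simp add: algebra_simps)
      then have "1 - \<delta> \<le> Lnorm p lborel mid" using A_pos by simp
      then have "Lnorm p lborel (\<lambda>u. g ?i u - g ?j u) \<le> e / 2"
        using \<delta>(2)[OF g g, of ?i ?j] ng by (simp add: mid_def[abs_def])
      then show ?thesis using e by simp
    qed
    then show ?thesis by blast
  qed
  obtain F where "F \<in> Lp_space p lborel" "(\<lambda>n. Lnorm p lborel (\<lambda>u. g (\<phi> n) u - F u)) \<longlonglongrightarrow> 0"
    using Lp_complete[OF p, of "\<lambda>n. g (\<phi> n)", OF g Cauchy] by blast
  then show thesis using that[OF \<phi>] by (simp add: g_def)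
qed

end

section \<open>Logarithmic coordinates\<close>

text \<open>Integrability is part of the conclusion. Together with the convention that divergent integrals are \<open>0\<close>,
this makes the identity of the integrals applicable to the operator at every point, also where its
integral diverges.\<close>
lemma change_of_variables_lborel:
  fixes F g g' :: "real \<Rightarrow> real"
  assumes S: "S \<in> sets borel" and T: "T = g ` S"
    and der: "\<And>x. x \<in> S \<Longrightarrow> (g has_real_derivative g' x) (at x)"
    and inj: "inj_on g S"
    and F: "(\<lambda>x. indicator T x * F x) \<in> borel_measurable borel"
    and gF: "(\<lambda>x. indicator S x * (\<bar>g' x\<bar> * F (g x))) \<in> borel_measurable borel"
  shows "integrable lborel (\<lambda>x. indicator T x * F x)
      \<longleftrightarrow> integrable lborel (\<lambda>x. indicator S x * (\<bar>g' x\<bar> * F (g x)))" (is "?I \<longleftrightarrow> ?J")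
    and "(LINT x|lborel. indicator T x * F x) = (LINT x|lborel. indicator S x * (\<bar>g' x\<bar> * F (g x)))"
proof -
  have cv: "((\<lambda>x. \<bar>g' x\<bar> * F (g x)) absolutely_integrable_on S \<and> integral S (\<lambda>x. \<bar>g' x\<bar> * F (g x)) = b)
      \<longleftrightarrow> (F absolutely_integrable_on T \<and> integral T F = b)" for b
    unfolding T using S der inj
    by (intro has_absolute_integral_change_of_variables_1')
      (auto intro: has_field_derivative_at_within)
  have 1: "F absolutely_integrable_on T \<longleftrightarrow> ?I"
    using F integrable_completion[of "\<lambda>x. indicator T x * F x" lborel] by (simp add: set_integrable_def)
  have 2: "(\<lambda>x. \<bar>g' x\<bar> * F (g x)) absolutely_integrable_on S \<longleftrightarrow> ?J"
    using gF integrable_completion[of "\<lambda>x. indicator S x * (\<bar>g' x\<bar> * F (g x))" lborel]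
    by (simp add: set_integrable_def)
  show iff: "?I \<longleftrightarrow> ?J" using cv 1 2 by blast
  show "(LINT x|lborel. indicator T x * F x) = (LINT x|lborel. indicator S x * (\<bar>g' x\<bar> * F (g x)))"
  proof (cases ?J)
    case True
    have "(LINT x|lborel. indicator T x * F x) = integral T F"
      using True iff 1 F integral_completion[of "\<lambda>x. indicator T x * F x" lborel]
        set_lebesgue_integral_eq_integral(2)[of T F]
      by (simp add: set_lebesgue_integral_def)
    also have "\<dots> = integral S (\<lambda>x. \<bar>g' x\<bar> * F (g x))"
      using cv True 2 by blast
    also have "\<dots> = (LINT x|lborel. indicator S x * (\<bar>g' x\<bar> * F (g x)))"
      using True 2 gF integral_completion[of "\<lambda>x. indicator S x * (\<bar>g' x\<bar> * F (g x))" lborel]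
        set_lebesgue_integral_eq_integral(2)[of S "\<lambda>x. \<bar>g' x\<bar> * F (g x)"]
      by (simp add: set_lebesgue_integral_def)
    finally show ?thesis .
  next
    case False
    then show ?thesis using iff by (simp add: not_integrable_integral_eq)
  qed
qed

text \<open>With \<open>a = m / P\<close> this is the isometry from \<open>L\<^sup>P(r\<^sup>m\<^sup>-\<^sup>1 dr)\<close> onto \<open>L\<^sup>P(\<real>)\<close> that carries dilations to
translations.\<close>
definition log_profile :: "real \<Rightarrow> (real \<Rightarrow> real) \<Rightarrow> real \<Rightarrow> real" where
  "log_profile a h t = exp (a * t) * h (exp t)"

definition of_log_profile :: "real \<Rightarrow> (real \<Rightarrow> real) \<Rightarrow> real \<Rightarrow> real" where
  "of_log_profile a g r = r powr (- a) * g (ln r)"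

lemma log_profile_of_log_profile [simp]: "log_profile a (of_log_profile a g) = g"
  by (simp add: log_profile_def of_log_profile_def fun_eq_iff powr_def flip: exp_add mult.assoc)

lemma borel_measurable_radial_iff:
  fixes h :: "real \<Rightarrow> real"
  shows "h \<in> borel_measurable (radial_measure m) \<longleftrightarrow> (\<lambda>r. indicator {0<..} r * h r) \<in> borel_measurable borel"
  using borel_measurable_restrict_space_iff[of "{0<..}" lborel h]
  by (simp add: radial_measure_def cong: measurable_cong_sets)

lemma radial_measurable_iff_log_profile:
  "h \<in> borel_measurable (radial_measure m) \<longleftrightarrow> log_profile a h \<in> borel_measurable borel"
proof
  assume "h \<in> borel_measurable (radial_measure m)"
  then have [measurable]: "(\<lambda>r. indicator {0<..} r * h r) \<in> borel_measurable borel"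
    by (simp add: borel_measurable_radial_iff)
  have "(\<lambda>t. exp (a * t) * (indicator {0<..} (exp t) * h (exp t))) \<in> borel_measurable borel"
    by (rule borel_measurable_times[OF _ measurable_compose[of exp _ borel "\<lambda>r. indicator {0<..} r * h r"]]) measurable
  then show "log_profile a h \<in> borel_measurable borel" by (simp add: log_profile_def[abs_def])
next
  assume [measurable]: "log_profile a h \<in> borel_measurable borel"
  have "(\<lambda>r. indicator {0<..} r * (r powr (- a) * log_profile a h (ln r))) \<in> borel_measurable borel"
    by measurable
  also have "(\<lambda>r. indicator {0<..} r * (r powr (- a) * log_profile a h (ln r))) = (\<lambda>r. indicator {0<..} r * h r)"
    by (auto simp: fun_eq_iff log_profile_def powr_def split: split_indicator simp flip: exp_add mult.assoc)
  finally show "h \<in> borel_measurable (radial_measure m)" by (simp add: borel_measurable_radial_iff)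
qed

lemma
  assumes h: "h \<in> borel_measurable (radial_measure m)"
  shows integrable_radial_iff: "integrable (radial_measure m) h
      \<longleftrightarrow> integrable lborel (\<lambda>r. indicator {0<..} r * (r ^ (m - 1) * h r))"
    and integral_radial: "integral\<^sup>L (radial_measure m) h
      = (LINT r|lborel. indicator {0<..} r * (r ^ (m - 1) * h r))"
proof -
  let ?M = "restrict_space lborel {0<..} :: real measure"
  have 1: "h \<in> borel_measurable ?M" using h by (simp add: radial_measure_def cong: measurable_cong_sets)
  have 2: "(\<lambda>r. r ^ (m - 1)) \<in> borel_measurable ?M" by (intro measurable_restrict_space1) measurable
  have 3: "AE r in ?M. (0::real) \<le> r ^ (m - 1)" by (rule AE_I2) (simp add: space_restrict_space)
  show "integrable (radial_measure m) h \<longleftrightarrow> integrable lborel (\<lambda>r. indicator {0<..} r * (r ^ (m - 1) * h r))"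
    unfolding radial_measure_def integrable_density[OF 1 2 3] by (subst integrable_restrict_space) auto
  show "integral\<^sup>L (radial_measure m) h = (LINT r|lborel. indicator {0<..} r * (r ^ (m - 1) * h r))"
    unfolding radial_measure_def integral_density[OF 1 2 3] by (subst integral_restrict_space) auto
qed

lemma
  assumes m: "1 \<le> m" and P: "0 < P" and h: "h \<in> borel_measurable (radial_measure m)"
  shows radial_integrable_log: "integrable (radial_measure m) (\<lambda>r. \<bar>h r\<bar> powr P)
      \<longleftrightarrow> integrable lborel (\<lambda>t. \<bar>log_profile (m / P) h t\<bar> powr P)"
    and radial_integral_log: "(LINT r|radial_measure m. \<bar>h r\<bar> powr P)
      = (LINT t|lborel. \<bar>log_profile (m / P) h t\<bar> powr P)"
proof -
  have [measurable]: "log_profile (m / P) h \<in> borel_measurable borel"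
    using h radial_measurable_iff_log_profile by blast
  have hP: "(\<lambda>r. \<bar>h r\<bar> powr P) \<in> borel_measurable (radial_measure m)"
    using h by measurable
  have range: "{0<..} = range (exp :: real \<Rightarrow> real)"
    by (auto simp: image_iff) (metis exp_ln)
  have eq: "indicator UNIV t * (\<bar>exp t\<bar> * (exp t ^ (m - 1) * \<bar>h (exp t)\<bar> powr P))
      = \<bar>log_profile (m / P) h t\<bar> powr P" for t :: real
  proof -
    have "exp t * exp t ^ (m - 1) = exp t ^ m" using m by (cases m) auto
    also have "\<dots> = exp (m / P * t) powr P"
      using P by (simp add: powr_def flip: exp_of_nat_mult)
    finally have "exp t * exp t ^ (m - 1) = exp (m / P * t) powr P" .
    then show ?thesis by (simp add: log_profile_def abs_mult powr_mult flip: mult.assoc)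
  qed
  have F: "(\<lambda>r. indicator {0<..} r * (r ^ (m - 1) * \<bar>h r\<bar> powr P)) \<in> borel_measurable borel"
  proof -
    have "(\<lambda>r. r ^ (m - 1) * \<bar>h r\<bar> powr P) \<in> borel_measurable (radial_measure m)"
      using h by (intro borel_measurable_times hP) (simp add: borel_measurable_radial_iff)
    then show ?thesis by (simp add: borel_measurable_radial_iff)
  qed
  note cv = change_of_variables_lborel[of UNIV "{0<..}" exp exp "\<lambda>r. r ^ (m - 1) * \<bar>h r\<bar> powr P", unfolded eq,
      OF _ range DERIV_exp inj_onI F]
  show "integrable (radial_measure m) (\<lambda>r. \<bar>h r\<bar> powr P)
      \<longleftrightarrow> integrable lborel (\<lambda>t. \<bar>log_profile (m / P) h t\<bar> powr P)"
    unfolding integrable_radial_iff[OF hP] by (rule cv) simp_all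
  show "(LINT r|radial_measure m. \<bar>h r\<bar> powr P) = (LINT t|lborel. \<bar>log_profile (m / P) h t\<bar> powr P)"
    unfolding integral_radial[OF hP] by (rule cv) simp_all
qed

lemma Lp_space_radial_iff:
  assumes "1 \<le> m" "0 < P"
  shows "h \<in> Lp_space P (radial_measure m) \<longleftrightarrow> log_profile (m / P) h \<in> Lp_space P lborel"
  using radial_integrable_log[OF assms, of h] radial_measurable_iff_log_profile[of h m "m / P"]
  by (auto simp: Lp_space_iff)

lemma Lnorm_radial:
  assumes "1 \<le> m" "0 < P" "h \<in> borel_measurable (radial_measure m)"
  shows "Lnorm P (radial_measure m) h = Lnorm P lborel (log_profile (m / P) h)"
  using radial_integral_log[OF assms] by (simp add: Lnorm_def)

text \<open>The density with respect to \<open>dv\<close> of the weight \<open>\<sigma>\<^sup>k\<^sup>-\<^sup>1 d\<sigma>\<close>, where \<open>v = ln (sqrt (1 + \<sigma>\<^sup>2))\<close>, multiplied by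
\<open>exp (- a * v)\<close>. Near \<open>0\<close> it behaves like \<open>(2 * v) powr (k / 2 - 1)\<close>, near infinity like
\<open>exp ((k - a) * v)\<close>.\<close>
definition log_kernel :: "real \<Rightarrow> nat \<Rightarrow> real \<Rightarrow> real" where
  "log_kernel a k v = (if 0 < v then exp ((2 - a) * v) * (exp (2 * v) - 1) powr (real k / 2 - 1) else 0)"

text \<open>Substitute \<open>s = r * sqrt (exp (2 * v) - 1)\<close> with \<open>r = exp t\<close>, so that \<open>sqrt (r\<^sup>2 + s\<^sup>2) = exp (t + v)\<close>.\<close>
lemma T_op_eq_conv:
  assumes k: "1 \<le> k" and h: "h \<in> borel_measurable (radial_measure m)"
  shows "T_op k h (exp t) = exp ((k - a) * t) * conv (log_kernel a k) (log_profile a h) t"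
proof -
  define h0 where "h0 r = indicator {0<..} r * h r" for r :: real
  have [measurable]: "h0 \<in> borel_measurable borel"
    using h by (simp add: borel_measurable_radial_iff h0_def[abs_def])
  define E where "E v = exp (2 * v) - 1" for v :: real
  have E: "0 < E v" if "0 < v" for v using that by (simp add: E_def)
  define g where "g v = exp t * sqrt (E v)" for v
  define g' where "g' v = exp t * (exp (2 * v) / sqrt (E v))" for v
  define F where "F s = h0 (sqrt ((exp t)\<^sup>2 + s\<^sup>2)) * s ^ (k - 1)" for s
  have [measurable]: "F \<in> borel_measurable borel" "g \<in> borel_measurable borel" "g' \<in> borel_measurable borel"
    unfolding F_def g_def g'_def E_def by measurable
  have der: "(g has_real_derivative g' v) (at v)" if "v \<in> {0<..}" for v
    using that E[of v] unfolding g_def g'_def E_def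
    by (auto intro!: derivative_eq_intros simp: field_simps)
  have inj: "inj_on g {0<..}"
    by (auto simp: inj_on_def g_def E_def)
  have range: "{0<..} = g ` {0<..}"
  proof (intro equalityI subsetI)
    fix y :: real assume "y \<in> {0<..}"
    then have y: "0 < y / exp t" by simp
    define v where "v = ln (1 + (y / exp t)\<^sup>2) / 2"
    have pos: "0 < 1 + (y / exp t)\<^sup>2" by (simp add: add_pos_nonneg)
    have "1 < 1 + (y / exp t)\<^sup>2" using zero_less_power[OF y, of 2] by linarith
    then have "0 < v" unfolding v_def by (intro divide_pos_pos ln_gt_zero) simp_all
    have "E v = (y / exp t)\<^sup>2" using pos by (simp add: E_def v_def)
    then have "g v = y" using \<open>y \<in> {0<..}\<close> by (simp add: g_def)
    with \<open>0 < v\<close> show "y \<in> g ` {0<..}" by force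
  next
    fix y assume "y \<in> g ` {0<..}"
    then show "y \<in> {0<..}" using E by (auto simp: g_def)
  qed
  have eq: "indicator {0<..} v * (\<bar>g' v\<bar> * F (g v))
      = exp ((k - a) * t) * (log_profile a h (t + v) * log_kernel a k v)" for v
  proof (cases "0 < v")
    case True
    note Ev = E[OF True]
    have "(exp t)\<^sup>2 + (g v)\<^sup>2 = (exp t)\<^sup>2 * exp (2 * v)"
      using Ev by (simp add: g_def power_mult_distrib) (simp add: E_def algebra_simps)
    also have "\<dots> = (exp (t + v))\<^sup>2"
      by (simp add: exp_add power_mult_distrib exp_double)
    finally have "sqrt ((exp t)\<^sup>2 + (g v)\<^sup>2) = exp (t + v)" by simp
    then have Fg: "F (g v) = h (exp (t + v)) * (exp t ^ (k - 1) * sqrt (E v) ^ (k - 1))"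
      by (simp add: F_def h0_def g_def power_mult_distrib)
    have "sqrt (E v) ^ (k - 1) / sqrt (E v) = E v powr (real k / 2 - 1)"
    proof -
      have "sqrt (E v) ^ (k - 1) = (E v powr (1 / 2)) powr real (k - 1)"
        using Ev by (simp add: powr_half_sqrt powr_realpow)
      also have "\<dots> = E v powr ((real k - 1) / 2)"
        using k by (simp add: powr_powr of_nat_diff)
      finally have "sqrt (E v) ^ (k - 1) / sqrt (E v) = E v powr ((real k - 1) / 2) / E v powr (1 / 2)"
        using Ev by (simp add: powr_half_sqrt)
      also have "\<dots> = E v powr (real k / 2 - 1)"
        by (simp add: diff_divide_distrib flip: powr_diff)
      finally show ?thesis .
    qed
    moreover have "exp t * exp t ^ (k - 1) = exp (k * t)"
      unfolding exp_of_nat_mult using k by (cases k) auto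
    ultimately have "\<bar>g' v\<bar> * F (g v) = exp (k * t) * exp (2 * v) * h (exp (t + v)) * E v powr (real k / 2 - 1)"
      using Ev unfolding g'_def Fg by (simp add: abs_mult field_simps)
    also have "exp (k * t) * exp (2 * v) = exp ((k - a) * t) * (exp (a * (t + v)) * exp ((2 - a) * v))"
      by (simp add: algebra_simps flip: exp_add)
    finally show ?thesis using True by (simp add: log_profile_def log_kernel_def E_def mult_ac)
  qed (simp add: log_kernel_def)
  have "T_op k h (exp t) = (LINT s|lborel. indicator {0<..} s * F s)"
  proof -
    have "0 < sqrt ((exp t)\<^sup>2 + s\<^sup>2)" for s :: real by (simp add: add_pos_nonneg)
    then have "h0 (sqrt ((exp t)\<^sup>2 + s\<^sup>2)) = h (sqrt ((exp t)\<^sup>2 + s\<^sup>2))" for s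
      unfolding h0_def by (simp only: greaterThan_iff indicator_simps)
    then show ?thesis by (simp add: T_op_def set_lebesgue_integral_def F_def)
  qed
  also have "\<dots> = (LINT v|lborel. indicator {0<..} v * (\<bar>g' v\<bar> * F (g v)))"
    by (rule change_of_variables_lborel(2)[OF _ range der inj]) measurable
  also have "\<dots> = exp ((k - a) * t) * conv (log_kernel a k) (log_profile a h) t"
    unfolding eq by (simp add: conv_def)
  finally show ?thesis .
qed

section \<open>The kernel in logarithmic coordinates\<close>

text \<open>The integral is \<open>Gamma (1 - \<sigma>) * b powr (\<sigma> - 1)\<close>.\<close>
lemma integrable_powr_exp:
  fixes b \<sigma> :: real
  assumes "0 < b" "\<sigma> < 1"
  shows "integrable lborel (\<lambda>v. indicator {0<..} v * (v powr (- \<sigma>) / exp (b * v)))"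
proof -
  let ?f = "\<lambda>t. complex_of_real t powr (complex_of_real (1 - \<sigma>) - 1) / complex_of_real (exp (b * t))"
  have "set_integrable lebesgue {0<..} ?f"
    using assms by (intro absolutely_integrable_Gamma_integral) auto
  then have "integrable lebesgue (\<lambda>t. norm (indicator {0<..} t *\<^sub>R ?f t))"
    unfolding set_integrable_def by (rule integrable_norm)
  also have "(\<lambda>t. norm (indicator {0<..} t *\<^sub>R ?f t)) = (\<lambda>t. indicator {0<..} t * (t powr (- \<sigma>) / exp (b * t)))"
    by (auto simp: fun_eq_iff norm_divide norm_powr_real_powr split: split_indicator)
  finally show ?thesis
    by (subst (asm) integrable_completion) measurable
qed

lemma borel_measurable_log_kernel [measurable]: "log_kernel a k \<in> borel_measurable borel"
  unfolding log_kernel_def[abs_def] by measurable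

lemma log_kernel_pos: "0 < v \<Longrightarrow> 0 < log_kernel a k v"
  by (simp add: log_kernel_def)

lemma log_kernel_nonneg: "0 \<le> log_kernel a k v"
  by (simp add: log_kernel_def)

lemma continuous_on_log_kernel: "continuous_on {0<..} (log_kernel a k)"
proof -
  have "continuous_on {0<..} (\<lambda>v::real. exp ((2 - a) * v) * (exp (2 * v) - 1) powr (real k / 2 - 1))"
    by (intro continuous_intros) auto
  then show ?thesis
    by (rule continuous_on_eq) (simp add: log_kernel_def)
qed

text \<open>With \<open>w = 1 - exp (- 2 * v)\<close> the kernel equals \<open>exp ((k - a) * v) * w powr (k / 2 - 1)\<close>. The second factor is
at most \<open>1\<close> if \<open>k \<ge> 2\<close>; for \<open>k = 1\<close> its \<open>s\<close>-th power is of order \<open>v powr (- s / 2)\<close> at \<open>0\<close>.\<close>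
lemma log_kernel_in_Lp:
  assumes k: "1 \<le> k" and a: "real k < a" and s: "0 < s" and ks: "k = 1 \<Longrightarrow> s < 2"
  shows "log_kernel a k \<in> Lp_space s lborel"
proof -
  define b where "b = (a - k) * s"
  define \<sigma> where "\<sigma> = (if k = 1 then s / 2 else 0)"
  have b: "0 < b" and \<sigma>: "0 \<le> \<sigma>" "\<sigma> < 1" using a s ks by (auto simp: b_def \<sigma>_def)
  define D where "D v = 2 * (indicator {0<..} v * (v powr (- \<sigma>) / exp (b * v)))
      + 2 * (indicator {0<..} v * (v powr (- 0) / exp (b * v)))" for v :: real
  have D: "integrable lborel D"
    unfolding D_def by (intro Bochner_Integration.integrable_add integrable_mult_right integrable_powr_exp b \<sigma>) simp
  have le: "\<bar>log_kernel a k v\<bar> powr s \<le> D v" for v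
  proof (cases "0 < v")
    case True
    define w where "w = 1 - exp (- 2 * v)"
    have w: "0 < w" "w < 1" using True by (auto simp: w_def)
    have "exp (2 * v) - 1 = exp (2 * v) * w"
      by (simp add: w_def right_diff_distrib flip: exp_add)
    then have "log_kernel a k v = exp ((2 - a) * v) * (exp (2 * v) powr (real k / 2 - 1) * w powr (real k / 2 - 1))"
      using True w by (simp add: log_kernel_def powr_mult)
    also have "exp (2 * v) powr (real k / 2 - 1) = exp ((real k - 2) * v)"
      by (simp add: powr_def algebra_simps)
    finally have "log_kernel a k v
        = exp ((2 - a) * v) * exp ((real k - 2) * v) * w powr (real k / 2 - 1)"
      by (simp only: mult.assoc)
    also have "exp ((2 - a) * v) * exp ((real k - 2) * v) = exp ((k - a) * v)"
      unfolding exp_add[symmetric] distrib_right[symmetric] by simp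
    finally have "log_kernel a k v = exp ((k - a) * v) * w powr (real k / 2 - 1)" .
    moreover have "exp ((k - a) * v) powr s = 1 / exp (b * v)"
    proof -
      have "exp ((k - a) * v) powr s = exp (- (b * v))"
        unfolding exp_powr_real by (simp add: b_def algebra_simps)
      then show ?thesis by (simp add: exp_minus inverse_eq_divide)
    qed
    ultimately have eq: "\<bar>log_kernel a k v\<bar> powr s = w powr ((real k / 2 - 1) * s) / exp (b * v)"
      using w by (simp add: abs_mult powr_mult powr_powr)
    have "w powr ((real k / 2 - 1) * s) \<le> 2 * v powr (- \<sigma>) + 2"
    proof (cases "k = 1")
      case True
      have "1 + 2 * v \<le> exp (2 * v)" by (rule exp_ge_add_one_self)
      then have "exp (- (2 * v)) \<le> 1 / (1 + 2 * v)"
        using \<open>0 < v\<close> by (simp add: exp_minus inverse_eq_divide frac_le)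
      then have "2 * v / (1 + 2 * v) \<le> w" using \<open>0 < v\<close> by (simp add: w_def field_simps)
      then have "w powr (- \<sigma>) \<le> (2 * v / (1 + 2 * v)) powr (- \<sigma>)"
        using \<sigma> \<open>0 < v\<close> by (intro powr_mono2') auto
      also have "\<dots> \<le> 2 * v powr (- \<sigma>) + 2"
      proof (cases "1 \<le> 2 * v")
        case True
        then have "(2 * v / (1 + 2 * v)) powr (- \<sigma>) \<le> (1 / 2) powr (- \<sigma>)"
          using \<sigma> by (intro powr_mono2') (auto simp: field_simps)
        also have "\<dots> = 2 powr \<sigma>" by (simp add: powr_minus powr_divide)
        also have "\<dots> \<le> 2 powr 1" using \<sigma> by (intro powr_mono) auto
        finally have "(2 * v / (1 + 2 * v)) powr (- \<sigma>) \<le> 2" by simp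
        then show ?thesis by (simp add: add_increasing)
      next
        case False
        then have "(2 * v / (1 + 2 * v)) powr (- \<sigma>) \<le> v powr (- \<sigma>)"
          using \<sigma> \<open>0 < v\<close> by (intro powr_mono2') (auto simp: field_simps)
        moreover have "0 \<le> v powr (- \<sigma>)" by simp
        ultimately show ?thesis by linarith
      qed
      finally show ?thesis using True by (simp add: \<sigma>_def algebra_simps)
    next
      case False
      then have "0 \<le> real k / 2 - 1" using k by (cases k) auto
      then have "w powr ((real k / 2 - 1) * s) \<le> 1"
        using w s by (intro powr_le1) auto
      moreover have "0 \<le> v powr (- \<sigma>)" by simp
      ultimately show ?thesis by linarith
    qed
    then have "w powr ((real k / 2 - 1) * s) / exp (b * v) \<le> (2 * v powr (- \<sigma>) + 2) / exp (b * v)"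
      by (intro divide_right_mono) auto
    also have "\<dots> = D v" using True by (simp add: D_def add_divide_distrib)
    finally show ?thesis by (simp add: eq)
  qed (simp add: D_def log_kernel_def)
  have "integrable lborel (\<lambda>v. \<bar>log_kernel a k v\<bar> powr s)"
    by (rule Bochner_Integration.integrable_bound[OF D]) (use le in \<open>auto intro: order_trans[OF _ abs_ge_self]\<close>)
  then show ?thesis by (simp add: Lp_space_iff)
qed

text \<open>Multiplication by continuous cutoffs \<open>\<omega> N\<close> that vanish outside \<open>[1 / N, N + 1]\<close> and increase to \<open>1\<close> on
\<open>(0, \<infinity>)\<close>, and dominated convergence.\<close>
lemma approx_by_continuous_compact_support:
  fixes K :: "real \<Rightarrow> real"
  assumes cont: "continuous_on {0<..} K" and zero: "\<And>v. v \<le> 0 \<Longrightarrow> K v = 0"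
    and K: "K \<in> Lp_space s lborel" and s: "0 < s" and e: "0 < e"
  shows "\<exists>H L. 0 < L \<and> continuous_on UNIV H \<and> (\<forall>v. L < \<bar>v\<bar> \<longrightarrow> H v = 0)
      \<and> H \<in> Lp_space s lborel \<and> Lnorm s lborel (\<lambda>v. K v - H v) \<le> e"
proof -
  have [measurable]: "K \<in> borel_measurable borel" using Lp_space_measurable[OF K] by simp
  define clamp where "clamp x = max 0 (min 1 x)" for x :: real
  have clamp: "0 \<le> clamp x" "clamp x \<le> 1" for x by (auto simp: clamp_def)
  define \<omega> where "\<omega> N v = clamp (real N * v - 1) * clamp (real N + 1 - v)" for N v
  have \<omega>: "0 \<le> \<omega> N v" "\<omega> N v \<le> 1" for N v
    using clamp by (auto simp: \<omega>_def mult_le_one)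
  have [measurable]: "\<omega> N \<in> borel_measurable borel" for N
    unfolding \<omega>_def clamp_def by measurable
  have lim: "(\<lambda>N. LINT v|lborel. \<bar>K v - K v * \<omega> N v\<bar> powr s) \<longlonglongrightarrow> (LINT v::real|lborel. (0::real))"
  proof (rule integral_dominated_convergence[where w = "\<lambda>v. \<bar>K v\<bar> powr s"])
    show "AE v in lborel. (\<lambda>N. \<bar>K v - K v * \<omega> N v\<bar> powr s) \<longlonglongrightarrow> 0"
    proof (rule AE_I2)
      fix v :: real
      have "\<forall>\<^sub>F N in sequentially. \<bar>K v - K v * \<omega> N v\<bar> powr s = 0"
      proof (cases "0 < v")
        case True
        obtain N0 :: nat where N0: "max v (2 / v) \<le> N0" using real_arch_simple by blast
        show ?thesis
        proof (rule eventually_sequentiallyI[of N0])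
          fix N assume "N0 \<le> N"
          then have "max v (2 / v) \<le> real N" using N0 by (simp add: order_trans[of _ "real N0"])
          then have "2 \<le> real N * v" "v \<le> real N" using True by (auto simp: pos_divide_le_eq)
          then have "\<omega> N v = 1" by (simp add: \<omega>_def clamp_def)
          then show "\<bar>K v - K v * \<omega> N v\<bar> powr s = 0" by simp
        qed
      qed (simp add: zero)
      then show "(\<lambda>N. \<bar>K v - K v * \<omega> N v\<bar> powr s) \<longlonglongrightarrow> 0" by (rule tendsto_eventually)
    qed
    show "AE v in lborel. norm (\<bar>K v - K v * \<omega> N v\<bar> powr s) \<le> \<bar>K v\<bar> powr s" for N
    proof (rule AE_I2)
      fix v
      have "\<bar>K v - K v * \<omega> N v\<bar> = \<bar>K v\<bar> * (1 - \<omega> N v)"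
        using \<omega>[of N v] by (simp add: abs_mult flip: right_diff_distrib[of "K v" 1, simplified])
      also have "\<dots> \<le> \<bar>K v\<bar>" using \<omega>[of N v] by (simp add: mult_left_le)
      finally show "norm (\<bar>K v - K v * \<omega> N v\<bar> powr s) \<le> \<bar>K v\<bar> powr s"
        using s by (simp add: powr_mono2)
    qed
  qed (use Lp_space_integrable[OF K] in measurable)
  have "0 < e powr s" using e by simp
  then have "\<forall>\<^sub>F N in sequentially. (LINT v|lborel. \<bar>K v - K v * \<omega> N v\<bar> powr s) < e powr s"
    using order_tendstoD(2)[OF lim, of "e powr s"] by simp
  then have "\<forall>\<^sub>F N in sequentially. 0 < N \<and> (LINT v|lborel. \<bar>K v - K v * \<omega> N v\<bar> powr s) < e powr s"
    using eventually_gt_at_top[of 0] by eventually_elim simp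
  then obtain N where N: "0 < N" "(LINT v|lborel. \<bar>K v - K v * \<omega> N v\<bar> powr s) < e powr s"
    by (auto simp: eventually_sequentially)
  have norm: "Lnorm s lborel (\<lambda>v. K v - K v * \<omega> N v) \<le> e"
    using N s e by (subst Lnorm_le_iff) auto
  have H_Lp: "(\<lambda>v. K v * \<omega> N v) \<in> Lp_space s lborel"
  proof (rule Lp_space_dominated[OF s K])
    show "AE v in lborel. \<bar>K v * \<omega> N v\<bar> \<le> \<bar>K v\<bar>"
      using \<omega> by (simp add: abs_mult mult_left_le)
  qed measurable
  \<comment> \<open>Where \<open>v < 1 / N\<close> the cutoff vanishes, so the argument of \<open>K\<close> may be moved into \<open>(0, \<infinity>)\<close>, where \<open>K\<close> is
      continuous.\<close>
  have "continuous_on UNIV (\<lambda>v. K (max v (1 / N)) * \<omega> N v)"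
    unfolding \<omega>_def clamp_def
    by (intro continuous_intros continuous_on_compose2[OF cont]) (use N in \<open>auto simp: less_max_iff_disj\<close>)
  moreover have "K (max v (1 / N)) * \<omega> N v = K v * \<omega> N v" for v
  proof (cases "1 / N \<le> v")
    case False
    then have "real N * v - 1 \<le> 0" using N by (simp add: field_simps)
    then show ?thesis by (simp add: \<omega>_def clamp_def)
  qed (simp add: max_absorb1)
  ultimately have cont_H: "continuous_on UNIV (\<lambda>v. K v * \<omega> N v)" by simp
  have supp: "K v * \<omega> N v = 0" if "real N + 1 < \<bar>v\<bar>" for v
    using that zero[of v] by (cases "v \<le> 0") (auto simp: \<omega>_def clamp_def)
  show ?thesis
    by (intro exI[of _ "\<lambda>v. K v * \<omega> N v"] exI[of _ "real N + 1"] conjI allI impI cont_H supp H_Lp norm) auto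
qed

text \<open>This makes the optimal constant positive; with constant \<open>0\<close> every normalized sequence would be
extremizing. On \<open>[0, 1]\<close>, the image of the indicator of \<open>[0, 3]\<close> is at least the minimum of \<open>K\<close> over \<open>[1, 2]\<close>.\<close>
lemma (in Young_exponents) exists_conv_nonzero:
  assumes K: "K \<in> Lp_space s lborel"
    and cont: "continuous_on {0<..} K" and pos: "\<And>v. 0 < v \<Longrightarrow> 0 < K v" and nonneg: "\<And>v. 0 \<le> K v"
  obtains g where "g \<in> Lp_space p lborel" "0 < Lnorm q lborel (conv K g)"
proof -
  define g :: "real \<Rightarrow> real" where "g = indicator {0..3}"
  have "(\<lambda>u. \<bar>g u\<bar> powr p) = g" using p by (auto simp: g_def fun_eq_iff split: split_indicator)
  then have g: "g \<in> Lp_space p lborel"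
    by (auto simp: Lp_space_iff g_def)
  have "continuous_on {1..2} K" by (rule continuous_on_subset[OF cont]) auto
  then obtain v0 where v0: "v0 \<in> {1..2}" "\<And>v. v \<in> {1..2} \<Longrightarrow> K v0 \<le> K v"
    using continuous_attains_inf[of "{1..2}" K] by auto
  have K0: "0 < K v0" using v0 pos by auto
  have "Lnorm q lborel (conv K g) \<noteq> 0"
  proof
    assume "Lnorm q lborel (conv K g) = 0"
    then have "(LINT t|lborel. \<bar>conv K g t\<bar> powr q) = 0" by (simp add: Lnorm_def)
    then have zero: "AE t in lborel. conv K g t = 0"
      using Lp_space_integrable[OF conv_in_Lq[OF g K]] by (simp add: integral_nonneg_eq_0_iff_AE)
    have "AE t in lborel. t \<notin> {0..1::real}"
      using zero AE_conv_integrable[OF g K]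
    proof eventually_elim
      case (elim t)
      show ?case
      proof
        assume t: "t \<in> {0..1}"
        have "K v0 = (LINT v|lborel. indicator {1..2::real} v * K v0)" by simp
        also have "\<dots> \<le> (LINT v|lborel. g (t + v) * K v)"
        proof (rule integral_mono)
          show "indicator {1..2} v * K v0 \<le> g (t + v) * K v" for v
            using t v0(2)[of v] nonneg[of v] by (auto simp: g_def split: split_indicator)
        qed (use elim(2) in auto)
        finally show False using elim(1) K0 by (simp add: conv_def)
      qed
    qed
    then have "emeasure lborel {t \<in> space lborel. \<not> t \<notin> {0..1::real}} = 0"
      by (subst (asm) AE_iff_measurable[OF _ refl]) simp_all
    moreover have "{t \<in> space lborel. \<not> t \<notin> {0..1::real}} = {0..1}" by auto
    ultimately show False by simp
  qed
  then show thesis using that[OF g] Lnorm_nonneg[of q lborel "conv K g"] by linarith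
qed

text \<open>The powers of \<open>r\<close> cancel, since \<open>(d - k) / q + k = d / p\<close>: this is the scale invariance of the
inequality.\<close>
lemma T_op_radial_profile:
  assumes d: "1 \<le> k" "k \<le> d - 1" and p: "p = (real d + 1) / (real k + 1)" and q: "q = real d + 1"
    and h: "h \<in> borel_measurable (radial_measure d)"
  shows "log_profile (real (d - k) / q) (T_op k h) = conv (log_kernel (d / p) k) (log_profile (d / p) h)"
proof
  fix t :: real
  have kd: "k \<le> d" using d by simp
  have "real (d - k) / q + (k - d / p) = 0"
    using kd by (simp add: p q of_nat_diff field_simps)
  then have "exp (real (d - k) / q * t) * exp ((k - d / p) * t) = 1"
    unfolding exp_add[symmetric] distrib_right[symmetric] by simp
  then show "log_profile (real (d - k) / q) (T_op k h) t = conv (log_kernel (d / p) k) (log_profile (d / p) h) t"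
    unfolding log_profile_def[of _ "T_op k h"] T_op_eq_conv[OF d(1) h, of t "d / p"]
    by (simp flip: mult.assoc)
qed

section \<open>Extremizing sequences of the radial operator\<close>

text \<open>The finiteness of \<^const>\<open>A_const\<close> is Young's inequality. The bound for \<open>g\<close> follows from the definition by
applying it to the radial function with profile \<open>g\<close>.\<close>
lemma (in Young_exponents) A_const_as_operator_norm:
  assumes le: "1 \<le> k" "k \<le> d - 1" and p_eq: "p = (real d + 1) / (real k + 1)" and q_eq: "q = real d + 1"
  assumes K: "log_kernel (d / p) k \<in> Lp_space s lborel"
  obtains A where "0 < A" "A_const d k p q = ennreal A"
    "\<And>g. g \<in> Lp_space p lborel \<Longrightarrow> Lnorm q lborel (conv (log_kernel (d / p) k) g) \<le> A * Lnorm p lborel g"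
    "\<And>h. h \<in> Lp_space p (radial_measure d) \<Longrightarrow> Lp_norm q (radial_measure (d - k)) (T_op k h)
      = ennreal (Lnorm q lborel (conv (log_kernel (d / p) k) (log_profile (d / p) h)))"
proof -
  define a where "a = d / p"
  define K where "K = log_kernel a k"
  have K_Lp: "K \<in> Lp_space s lborel" using K by (simp add: K_def a_def)
  have dims: "1 \<le> d" "1 \<le> d - k" using le by auto
  have Lp_iff: "h \<in> Lp_space p (radial_measure d) \<longleftrightarrow> log_profile a h \<in> Lp_space p lborel" for h
    unfolding a_def by (rule Lp_space_radial_iff[OF dims(1) p_pos])
  have norm_p: "Lp_norm p (radial_measure d) h = ennreal (Lnorm p lborel (log_profile a h))"
    if "h \<in> Lp_space p (radial_measure d)" for h
    using Lp_norm_eq_Lnorm[OF that] Lnorm_radial[OF dims(1) p_pos Lp_space_measurable[OF that]]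
    by (simp add: a_def)
  have norm_q: "Lp_norm q (radial_measure (d - k)) (T_op k h) = ennreal (Lnorm q lborel (conv K (log_profile a h)))"
    if h: "h \<in> Lp_space p (radial_measure d)" for h
  proof -
    have eq: "log_profile (real (d - k) / q) (T_op k h) = conv K (log_profile a h)"
      unfolding K_def a_def by (rule T_op_radial_profile[OF le p_eq q_eq Lp_space_measurable[OF h]])
    have "conv K (log_profile a h) \<in> Lp_space q lborel"
      using h K_Lp by (intro conv_in_Lq) (simp_all add: Lp_iff)
    then have T: "T_op k h \<in> Lp_space q (radial_measure (d - k))"
      unfolding Lp_space_radial_iff[OF dims(2) q_pos] eq .
    show ?thesis
      unfolding Lp_norm_eq_Lnorm[OF T] Lnorm_radial[OF dims(2) q_pos Lp_space_measurable[OF T]] eq ..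
  qed
  define Cs where "Cs = {C. \<forall>f \<in> Lp_space p (radial_measure d).
      Lp_norm q (radial_measure (d - k)) (T_op k f) \<le> C * Lp_norm p (radial_measure d) f}"
  have A_eq: "A_const d k p q = Inf Cs" by (simp add: A_const_def Cs_def)
  have "ennreal (Lnorm s lborel K) \<in> Cs"
    unfolding Cs_def
  proof (intro CollectI ballI)
    fix h assume h: "h \<in> Lp_space p (radial_measure d)"
    have "Lnorm q lborel (conv K (log_profile a h)) \<le> Lnorm s lborel K * Lnorm p lborel (log_profile a h)"
      using Young_inequality[of "log_profile a h" K] h K_Lp by (simp add: Lp_iff mult.commute)
    then show "Lp_norm q (radial_measure (d - k)) (T_op k h)
        \<le> ennreal (Lnorm s lborel K) * Lp_norm p (radial_measure d) h"
      unfolding norm_p[OF h] norm_q[OF h] by (simp add: ennreal_leI flip: ennreal_mult)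
  qed
  then have "Inf Cs \<le> ennreal (Lnorm s lborel K)" by (rule Inf_lower)
  then have "Inf Cs < \<infinity>" by (rule order_le_less_trans) simp
  then obtain A where A: "0 \<le> A" "Inf Cs = ennreal A" by (cases "Inf Cs") auto
  have bound: "Lnorm q lborel (conv K g) \<le> A * Lnorm p lborel g" if g: "g \<in> Lp_space p lborel" for g
  proof (cases "Lnorm p lborel g = 0")
    case True
    then show ?thesis using Young_inequality[OF g K_Lp] by simp
  next
    case False
    then have pos: "0 < Lnorm p lborel g" using Lnorm_nonneg[of p lborel g] by linarith
    have h: "of_log_profile a g \<in> Lp_space p (radial_measure d)" using g by (simp add: Lp_iff)
    have "ennreal (Lnorm q lborel (conv K g) / Lnorm p lborel g) \<le> C" if "C \<in> Cs" for C
    proof (cases C)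
      case (real c)
      have "ennreal (Lnorm q lborel (conv K g)) \<le> ennreal c * ennreal (Lnorm p lborel g)"
        using that h norm_p[OF h] norm_q[OF h] by (auto simp: Cs_def real)
      also have "\<dots> = ennreal (c * Lnorm p lborel g)" using real by (simp add: ennreal_mult)
      finally have "Lnorm q lborel (conv K g) \<le> c * Lnorm p lborel g"
        using real pos by (subst (asm) ennreal_le_iff) auto
      then have "Lnorm q lborel (conv K g) / Lnorm p lborel g \<le> c" using pos by (simp add: pos_divide_le_eq)
      then show ?thesis unfolding real by (rule ennreal_leI)
    qed simp
    then have "ennreal (Lnorm q lborel (conv K g) / Lnorm p lborel g) \<le> ennreal A"
      unfolding A(2)[symmetric] by (rule Inf_greatest)
    then have "Lnorm q lborel (conv K g) / Lnorm p lborel g \<le> A" using A(1) by (subst (asm) ennreal_le_iff) auto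
    then show ?thesis using pos by (simp add: pos_divide_le_eq)
  qed
  obtain g where g: "g \<in> Lp_space p lborel" "0 < Lnorm q lborel (conv K g)"
    using exists_conv_nonzero[OF K_Lp] continuous_on_log_kernel log_kernel_pos log_kernel_nonneg
    unfolding K_def by metis
  have "A \<noteq> 0" using bound[OF g(1)] g(2) by auto
  with A(1) have "0 < A" by simp
  then show thesis
    using that A(2) A_eq bound norm_q by (simp add: K_def a_def)
qed

theorem theorem5:
  fixes d k :: nat and p q :: real and f :: "nat \<Rightarrow> real \<Rightarrow> real"
  assumes "d \<ge> 2" and "1 \<le> k" and "k \<le> d - 1"
    and "p = (real d + 1) / (real k + 1)" and "q = real d + 1"
    and "extremizing_seq d k p q f"
  shows "\<exists>(\<phi> :: nat \<Rightarrow> nat) (lam :: nat \<Rightarrow> real) (F :: real \<Rightarrow> real).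
           strict_mono \<phi> \<and> (\<forall>n. lam (\<phi> n) > 0) \<and>
           F \<in> Lp_space p (radial_measure d) \<and>
           (\<lambda>n. Lp_norm p (radial_measure d)
                  (\<lambda>r. lam (\<phi> n) powr (real d / p) * f (\<phi> n) (lam (\<phi> n) * r) - F r))
             \<longlonglongrightarrow> 0"
proof -
  have kd: "k < d" using assms(1-3) by linarith
  have p1: "1 < p" using kd by (simp add: assms(4) less_divide_eq)
  define s where "s = (real d + 1) / (real d + 1 - real k)"
  define a where "a = d / p"
  define K where "K = log_kernel a k"
  have Y: "Young_exponents p q s"
  proof
    show "1 < p" by (rule p1)
    show "p < q" using assms(2) by (simp add: assms(4,5) divide_less_eq)
    show "0 < s" using kd by (simp add: s_def)
    show "1 / p + 1 / s = 1 + 1 / q"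
    proof -
      have "1 / p + 1 / s = (real k + 1) / (real d + 1) + (real d + 1 - real k) / (real d + 1)"
        by (simp add: assms(4) s_def)
      also have "\<dots> = (real d + 2) / (real d + 1)" by (simp flip: add_divide_distrib)
      also have "\<dots> = 1 + 1 / q" by (simp add: assms(5) field_simps)
      finally show ?thesis .
    qed
  qed
  interpret Young_exponents p q s by (rule Y)
  have a: "real k < a"
    using kd by (simp add: a_def assms(4) field_simps)
  have K_Lp: "K \<in> Lp_space s lborel"
    unfolding K_def using assms(1,2) a s by (intro log_kernel_in_Lp) (auto simp: s_def divide_less_eq)
  obtain A where A: "0 < A" "A_const d k p q = ennreal A"
    "\<And>g. g \<in> Lp_space p lborel \<Longrightarrow> Lnorm q lborel (conv K g) \<le> A * Lnorm p lborel g"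
    "\<And>h. h \<in> Lp_space p (radial_measure d) \<Longrightarrow> Lp_norm q (radial_measure (d - k)) (T_op k h)
      = ennreal (Lnorm q lborel (conv K (log_profile a h)))"
    using A_const_as_operator_norm[OF assms(2-5)] K_Lp unfolding K_def a_def by metis
  interpret extremal_kernel p q s K A
  proof
    show "\<exists>H L. 0 < L \<and> continuous_on UNIV H \<and> (\<forall>v. L < \<bar>v\<bar> \<longrightarrow> H v = 0)
      \<and> H \<in> Lp_space s lborel \<and> Lnorm s lborel (\<lambda>v. K v - H v) \<le> e" if "0 < e" for e
    proof (rule approx_by_continuous_compact_support[OF _ _ K_Lp s that])
      show "continuous_on {0<..} K" unfolding K_def by (rule continuous_on_log_kernel)
      show "K v = 0" if "v \<le> 0" for v using that by (simp add: K_def log_kernel_def)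
    qed
  qed (use A K_Lp in auto)
  have d1: "1 \<le> d" using assms(1) by simp
  have Lp_iff: "h \<in> Lp_space p (radial_measure d) \<longleftrightarrow> log_profile a h \<in> Lp_space p lborel" for h
    unfolding a_def by (rule Lp_space_radial_iff[OF d1 p_pos])
  have norm_p: "Lp_norm p (radial_measure d) h = ennreal (Lnorm p lborel (log_profile a h))"
    if "h \<in> Lp_space p (radial_measure d)" for h
    using Lp_norm_eq_Lnorm[OF that] Lnorm_radial[OF d1 p_pos Lp_space_measurable[OF that]]
    by (simp add: a_def)
  have f: "f n \<in> Lp_space p (radial_measure d)" "Lp_norm p (radial_measure d) (f n) = 1" for n
    using assms(6) by (auto simp: extremizing_seq_def)
  define g where "g n = log_profile a (f n)" for n
  have g: "g n \<in> Lp_space p lborel" for n using f(1) by (simp add: g_def Lp_iff)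
  have ng: "Lnorm p lborel (g n) = 1" for n
    using f(2)[of n] by (simp add: norm_p[OF f(1)] g_def ennreal_eq_1)
  have "(\<lambda>n. ennreal (Lnorm q lborel (conv K (g n)))) \<longlonglongrightarrow> ennreal A"
    using assms(6) by (simp add: extremizing_seq_def A(2) A(4)[OF f(1)] g_def)
  then have "(\<lambda>n. Lnorm q lborel (conv K (g n))) \<longlonglongrightarrow> A"
    using A(1) by (intro tendsto_ennrealD) auto
  from extremizing_precompact[OF g ng this]
  obtain \<phi> :: "nat \<Rightarrow> nat" and \<tau> :: "nat \<Rightarrow> real" and G where \<phi>: "strict_mono \<phi>"
    and G: "G \<in> Lp_space p lborel"
    and lim: "(\<lambda>n. Lnorm p lborel (\<lambda>u. g (\<phi> n) (\<tau> (\<phi> n) + u) - G u)) \<longlonglongrightarrow> 0"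
    by blast
  define lam where "lam n = exp (\<tau> n)" for n
  define F where "F = of_log_profile a G"
  have F: "F \<in> Lp_space p (radial_measure d)" using G by (simp add: Lp_iff F_def)
  have "Lp_norm p (radial_measure d) (\<lambda>r. lam n powr (real d / p) * f n (lam n * r) - F r)
      = ennreal (Lnorm p lborel (\<lambda>u. g n (\<tau> n + u) - G u))" for n
  proof -
    let ?h = "\<lambda>r. lam n powr (real d / p) * f n (lam n * r) - F r"
    have eq: "log_profile a ?h = (\<lambda>u. g n (\<tau> n + u) - G u)"
    proof
      fix u
      have "log_profile a ?h u = exp (a * u) * exp (a * \<tau> n) * f n (exp (\<tau> n + u)) - log_profile a F u"
        by (simp add: log_profile_def lam_def exp_powr_real a_def right_diff_distrib exp_add mult_ac)
      also have "exp (a * u) * exp (a * \<tau> n) = exp (a * (\<tau> n + u))"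
        by (simp add: exp_add distrib_left)
      finally show "log_profile a ?h u = g n (\<tau> n + u) - G u"
        by (simp add: g_def log_profile_def[of a "f n"] F_def)
    qed
    have "(\<lambda>u. g n (\<tau> n + u) - G u) \<in> Lp_space p lborel"
      by (intro Lp_space_diff p Lp_space_translate g G)
    then have h: "?h \<in> Lp_space p (radial_measure d)" unfolding Lp_iff eq .
    show ?thesis unfolding norm_p[OF h] eq ..
  qed
  moreover have "(\<lambda>n. ennreal (Lnorm p lborel (\<lambda>u. g (\<phi> n) (\<tau> (\<phi> n) + u) - G u))) \<longlonglongrightarrow> 0"
    using tendsto_ennrealI[OF lim] by simp
  ultimately show ?thesis
    using \<phi> F by (intro exI[of _ \<phi>] exI[of _ lam] exI[of _ F]) (simp add: lam_def)
qed

end
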